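(* Let $P_1,P_2,Q_1,Q_2\in C(K)$, and let $t=v/w\in K(C)$ with $v,w\in V_1$, $w(Q_1)\ne0$, $w(Q_2)\neq0$, be such that the meromorphic section $\frac{t-t(Q_2)}{t-t(Q_1)}$ of $\mathcal O_C(Q_1-Q_2)$ is regular and non-vanishing at $P_1$ and $P_2$. Let $d_2,e_2\in V_2$ and $d_3,e_3\in V_3$ be nonzero sections and $D,E$ effective divisors of degree $\delta$ on $C$ such that $$P_1-P_2=D+(d_2)_2-(d_3)_3,\qquad Q_1-Q_2=E+(e_2)_2-(e_3)_3,$$ with $D,D_0$ disjoint from $E,E_0$. Let $s\in V_1$ be a section not vanishing at $P_1$ or $P_2$. Suppose that $\frac{e_2}{v-t(Q_1)w}$ and $\frac{v-t(Q_2)w}{e_3}$ have order $0$ at $P_1$ and $P_2$, that $(d_2d_0)_3$ and $(d_3)_3$ are disjoint from $E$ and from $(s)_1$, and that $(s)_1$ and $E_0$ are disjoint from $D_0$ and from $D$. Put $$\mu=\left(\frac{e_2}{v-t(Q_1)w}\right)(P_1-P_2)\cdot\left(\frac{v-t(Q_2)w}{e_3}\right)(P_1-P_2),\qquad\lambda_s=\frac{s(P_1)}{s(P_2)},$$ $$\nu=\left(\frac{d_2d_0}{d_3}\right)(E)\cdot\left(\frac{d_3}{d_2d_0}\right)((s)_1)\cdot\left(\frac{s}{e_0}\right)(D_0)\cdot\left(\frac{e_0}{s}\right)(D).$$ Then $$\mathcal N_{P_1-P_2}\left(\frac{t-t(Q_2)}{t-t(Q_1)}\in\mathcal O_C(Q_1-Q_2)\right)=\mu\,\lambda_s\,\nu\cdot[D,E]$$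 in the fibre of $\mathcal P^\times$ at $([P_1-P_2],[Q_1-Q_2])$.
   Context: $K$ is a field, $C$ is a nonsingular, complete, geometrically integral curve over $K$ of genus $g$ with $C(K)\neq\emptyset$, and $J$ is its Jacobian, so $J(K)=\operatorname{Pic}^0(C)$. For a nonzero rational function $f$, $(f)$ is its divisor; if $F=\sum_P n_P P$ is a divisor with support disjoint from that of $(f)$, then $f(F)=\prod_P N_{\kappa(P)/K}(f(P))^{n_P}\in K^\times$. Norms: for a divisor $F=\sum_P n_PP$ and a line bundle $\mathcal M$ on $C$, $\mathcal N_F(\mathcal M)$ is the one-dimensional $K$-vector space $\bigotimes_P \mathrm{Norm}_{\kappa(P)/K}(\mathcal M|_P)^{\otimes n_P}$. It is additive in $F$ and functorial and multiplicative in $\mathcal M$. A meromorphic section $s$ of $\mathcal M$ which is regular and non-vanishing around $\operatorname{Supp}F$ has a nonzero norm $\mathcal N_F(s\in\mathcal M)$, and $\mathcal N_F(hs)=h(F)\,\mathcal N_F(s)$ for a function $h$ regular and non-vanishing around $\operatorname{Supp}F$. Poincaré torsor: $\mathcal P$ is the Poincaré (Mumford) bundle on $J\times J$ (identifying $J$ with its dual). For $x=[D]$, $y=[E]\in J(K)$ with $D,E\in\operatorname{Div}^0(C)$, its fibre at $(x,y)$ is $\mathcal P_{x,y}=\mathcal N_D(\mathcal O_C(E))$, where the spaces obtained from different choices of $D,E$ are identified as follows: (i) $\mathcal N_D(\mathcal O_C(E+(f)))\simeq\mathcal N_D(\mathcal O_C(E))$ is induced by the isomorphism $\mathcal O_C(E+(f))\to\mathcal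 O_C(E)$, $h\mapsto fh$; (ii) $\mathcal N_{D+(f)}(\mathcal O_C(E))\simeq\mathcal N_D(\mathcal O_C(E))$ identifies $\mathcal N_{D+(f)}(s)$ with $f((s)_E)\cdot\mathcal N_D(s)$, for any meromorphic section $s$ of $\mathcal O_C(E)$ whose divisor $(s)_E$ as a section of $\mathcal O_C(E)$ is disjoint from $D$ and from $(f)$. $\mathcal P^\times$ is $\mathcal P$ with its zero section removed; its fibres are $K^\times$-torsors, the action being written $\lambda\cdot\pi$. For $D,E\in\operatorname{Div}^0(C)$ with disjoint supports, $(D,E)$ denotes the point $\mathcal N_D(1\in\mathcal O_C(E))\in\mathcal P^\times_{[D],[E]}$. Fix a line bundle $\mathcal L$ on $C$ of degree $\delta\ge 2g+1$ and put $V_n=H^0(C,\mathcal L^{\otimes n})$. For $0\ne s\in V_n$, $(s)_n$ is its divisor as a section of $\mathcal L^{\otimes n}$. Fix nonzero $d_0,e_0\in V_1$ whose divisors $D_0=(d_0)_1$ and $E_0=(e_0)_1$ are disjoint. For effective divisors $D,E$ of degree $\delta$ such that $D$ and $D_0$ are disjoint from $E$ and $E_0$, put $[D,E]:=(D-D_0,\,E-E_0)\in\mathcal P^\times$. "Disjoint" means having disjoint supports. Fix local trivialisations of $\mathcal L$ at $P_1$ and $P_2$ (the same one if $P_1=P_2$), inducing trivialisations of all powers of $\mathcal L$ there. For a meromorphic section $h$ of a power of $\mathcal L$ having order $0$ at $P_1$ and $P_2$, $h(P_1-P_2)=h(P_1)/h(P_2)$, computed with these trivialisations; each of the factors of $\mu$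 and $\lambda_s$ depends on the trivialisations, but their product does not. *)

theory Defs
  imports
    "HOL-Library.Poly_Mapping"
    "HOL-Library.Function_Algebras"
    "HOL-Algebra.Algebraic_Closure_Type"
    "Jordan_Normal_Form.Determinant"
begin

section \<open>Curves\<close>

text \<open>
  A complete nonsingular integral curve \<open>C\<close> over \<open>K\<close> is given by its function field: \<open>K\<close> is the type
  \<open>'k\<close>, \<open>K(C)\<close> is the type \<open>'f\<close>, and \<open>\<iota> :: 'k \<Rightarrow> 'f\<close> is the inclusion of the constants. The closed
  points of \<open>C\<close> are the discrete valuation rings of \<open>K(C)/K\<close> (as in Hartshorne, Section I.6); a
  point is identified with its local ring, a subset of \<open>'f\<close>.
\<close>

definition function_field_one_var :: "('k::field \<Rightarrow> 'f::field) \<Rightarrow> bool" where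
  "function_field_one_var \<iota> \<longleftrightarrow> field_hom \<iota> \<and>
    (\<exists>x. (\<forall>p. p \<noteq> 0 \<longrightarrow> poly (map_poly \<iota> p) x \<noteq> 0) \<and>
      (\<exists>B. finite B \<and> (\<forall>f. \<exists>p q.
        f = (\<Sum>b\<in>B. poly (map_poly \<iota> (p b)) x / poly (map_poly \<iota> (q b)) x * b))))"

definition constants_closure :: "('k::field \<Rightarrow> 'f::field) \<Rightarrow> 'f alg_closure set" where
  "constants_closure \<iota> = {z. \<exists>p. p \<noteq> 0 \<and> poly (map_poly (\<lambda>c. to_ac (\<iota> c)) p) z = 0}"

text \<open>
  \<open>K(C) \<otimes> K\<^sup>a\<close> is a domain (hence a field, algebraic over \<open>K(C)\<close>) iff its canonical map to the
  algebraic closure of \<open>K(C)\<close> is injective, i.e. iff \<open>K(C)\<close> and \<open>K\<^sup>a\<close> are linearly disjoint over \<open>K\<close>.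
\<close>
definition geometrically_integral :: "('k::field \<Rightarrow> 'f::field) \<Rightarrow> bool" where
  "geometrically_integral \<iota> \<longleftrightarrow>
    (\<forall>B. finite B \<longrightarrow> \<not> module.dependent (\<lambda>c x. \<iota> c * x) B \<longrightarrow>
      (\<forall>z. (\<forall>b\<in>B. z b \<in> constants_closure \<iota>) \<longrightarrow> (\<Sum>b\<in>B. z b * to_ac b) = 0 \<longrightarrow>
        (\<forall>b\<in>B. z b = 0)))"

definition max_ideal :: "'f::field set \<Rightarrow> 'f set" where
  "max_ideal P = {x \<in> P. x = 0 \<or> inverse x \<notin> P}"

definition units_at :: "'f::field set \<Rightarrow> 'f set" where
  "units_at P = {x \<in> P. x \<noteq> 0 \<and> inverse x \<in> P}"

definition uniformizer :: "'f::field set \<Rightarrow> 'f \<Rightarrow> bool" where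
  "uniformizer P \<pi> \<longleftrightarrow> \<pi> \<noteq> 0 \<and> max_ideal P = (\<lambda>x. \<pi> * x) ` P"

definition closed_points :: "('k::field \<Rightarrow> 'f::field) \<Rightarrow> 'f set set" where
  "closed_points \<iota> = {P. range \<iota> \<subseteq> P \<and>
     (\<forall>x\<in>P. \<forall>y\<in>P. x + y \<in> P \<and> x * y \<in> P) \<and>
     (\<exists>\<pi>. uniformizer P \<pi> \<and> (\<forall>x. x \<noteq> 0 \<longrightarrow> (\<exists>u\<in>units_at P. \<exists>n. x = u * \<pi> powi n)))}"

definition ord_at :: "'f::field set \<Rightarrow> 'f \<Rightarrow> int" where
  "ord_at P x = (THE n. \<exists>\<pi> u. uniformizer P \<pi> \<and> u \<in> units_at P \<and> x = u * \<pi> powi n)"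

definition rational_points :: "('k::field \<Rightarrow> 'f::field) \<Rightarrow> 'f set set" where
  "rational_points \<iota> = {P \<in> closed_points \<iota>. \<forall>x\<in>P. \<exists>c. x - \<iota> c \<in> max_ideal P}"

definition value_at :: "('k::field \<Rightarrow> 'f::field) \<Rightarrow> 'f set \<Rightarrow> 'f \<Rightarrow> 'k" where
  "value_at \<iota> P x = (THE c. x - \<iota> c \<in> max_ideal P)"

definition quotient_basis ::
  "('k::field \<Rightarrow> 'v::ab_group_add \<Rightarrow> 'v) \<Rightarrow> 'v set \<Rightarrow> 'v set \<Rightarrow> 'v list \<Rightarrow> bool" where
  "quotient_basis scale V W bs \<longleftrightarrow> set bs \<subseteq> V \<and>
    (\<forall>x\<in>V. \<exists>!cs. length cs = length bs \<and>
       x - (\<Sum>i<length bs. scale (cs ! i) (bs ! i)) \<in> W)"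

definition residue_basis :: "('k::field \<Rightarrow> 'f::field) \<Rightarrow> 'f set \<Rightarrow> 'f list \<Rightarrow> bool" where
  "residue_basis \<iota> P bs \<longleftrightarrow> quotient_basis (\<lambda>c x. \<iota> c * x) P (max_ideal P) bs"

text \<open>\<open>[\<kappa>(P) : K]\<close>, and the norm \<open>\<kappa>(P) \<rightarrow> K\<close> of the class of \<open>x\<close>, for \<open>x\<close> in the local ring \<open>P\<close>.\<close>

definition point_degree :: "('k::field \<Rightarrow> 'f::field) \<Rightarrow> 'f set \<Rightarrow> nat" where
  "point_degree \<iota> P = (THE n. \<exists>bs. residue_basis \<iota> P bs \<and> length bs = n)"

definition residue_norm :: "('k::field \<Rightarrow> 'f::field) \<Rightarrow> 'f set \<Rightarrow> 'f \<Rightarrow> 'k" where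
  "residue_norm \<iota> P x = (THE c. \<exists>bs A. residue_basis \<iota> P bs \<and>
     A \<in> carrier_mat (length bs) (length bs) \<and>
     (\<forall>j<length bs. x * bs ! j - (\<Sum>i<length bs. \<iota> (A $$ (i, j)) * bs ! i) \<in> max_ideal P) \<and>
     c = det A)"

text \<open>
  The genus is \<open>dim H\<^sup>1(C, O)\<close>, computed from the flasque resolution of \<open>O\<close> by the constant sheaf
  \<open>K(C)\<close>: it is the space of repartitions modulo \<open>K(C)\<close> and the everywhere regular ones.
\<close>

definition repartitions :: "('k::field \<Rightarrow> 'f::field) \<Rightarrow> ('f set \<Rightarrow> 'f) set" where
  "repartitions \<iota> = {r. finite {P \<in> closed_points \<iota>. r P \<notin> P}}"

definition trivial_repartitions :: "('k::field \<Rightarrow> 'f::field) \<Rightarrow> ('f set \<Rightarrow> 'f) set" where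
  "trivial_repartitions \<iota> = {r. \<exists>f. \<forall>P\<in>closed_points \<iota>. r P - f \<in> P}"

definition has_genus :: "('k::field \<Rightarrow> 'f::field) \<Rightarrow> nat \<Rightarrow> bool" where
  "has_genus \<iota> g \<longleftrightarrow> (\<exists>bs. length bs = g \<and>
     quotient_basis (\<lambda>c r P. \<iota> c * r P) (repartitions \<iota>) (trivial_repartitions \<iota>) bs)"


section \<open>Divisors\<close>

type_synonym 'f divisor = "'f set \<Rightarrow>\<^sub>0 int"

definition is_divisor :: "('k::field \<Rightarrow> 'f::field) \<Rightarrow> 'f divisor \<Rightarrow> bool" where
  "is_divisor \<iota> D \<longleftrightarrow> Poly_Mapping.keys D \<subseteq> closed_points \<iota>"

definition div_degree :: "('k::field \<Rightarrow> 'f::field) \<Rightarrow> 'f divisor \<Rightarrow> int" where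
  "div_degree \<iota> D = (\<Sum>P\<in>Poly_Mapping.keys D. Poly_Mapping.lookup D P * int (point_degree \<iota> P))"

definition Div0 :: "('k::field \<Rightarrow> 'f::field) \<Rightarrow> 'f divisor set" where
  "Div0 \<iota> = {D. is_divisor \<iota> D \<and> div_degree \<iota> D = 0}"

definition effective :: "('k::field \<Rightarrow> 'f::field) \<Rightarrow> 'f divisor \<Rightarrow> bool" where
  "effective \<iota> D \<longleftrightarrow> is_divisor \<iota> D \<and> (\<forall>P. 0 \<le> Poly_Mapping.lookup D P)"

definition disjoint_div :: "'f divisor \<Rightarrow> 'f divisor \<Rightarrow> bool" where
  "disjoint_div D E \<longleftrightarrow> Poly_Mapping.keys D \<inter> Poly_Mapping.keys E = {}"

definition point :: "'f set \<Rightarrow> 'f divisor" where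
  "point P = Poly_Mapping.single P 1"

definition principal_div :: "('k::field \<Rightarrow> 'f::field) \<Rightarrow> 'f \<Rightarrow> 'f divisor" where
  "principal_div \<iota> f = Abs_poly_mapping (\<lambda>P. if P \<in> closed_points \<iota> then ord_at P f else 0)"

definition fun_at_div :: "('k::field \<Rightarrow> 'f::field) \<Rightarrow> 'f \<Rightarrow> 'f divisor \<Rightarrow> 'k" where
  "fun_at_div \<iota> f F =
    (\<Prod>P\<in>Poly_Mapping.keys F. residue_norm \<iota> P f powi Poly_Mapping.lookup F P)"

text \<open>The class of \<open>D\<close>; for \<open>D\<close> of degree \<open>0\<close> this is a point of \<open>J(K) = Pic\<^sup>0(C)\<close>.\<close>
definition div_class :: "('k::field \<Rightarrow> 'f::field) \<Rightarrow> 'f divisor \<Rightarrow> 'f divisor set" where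
  "div_class \<iota> D = {D + principal_div \<iota> f | f. f \<noteq> 0}"


section \<open>Line bundles\<close>

text \<open>
  A line bundle is given by the one-dimensional \<open>K(C)\<close>-space of its meromorphic sections (the type
  \<open>'m\<close> with scalar multiplication \<open>fscale\<close>) and, inside it, its stalks at the closed points.
  Two nonzero meromorphic sections differ by a rational function, whose divisor is finite of degree
  \<open>0\<close>; so the conditions below on all nonzero sections \<open>m\<close> (finiteness in \<open>is_line_bundle\<close>, the degree
  in \<open>has_degree\<close>) amount to the same condition on a single one.
\<close>

record ('f, 'm) line_bundle =
  fscale :: "'f \<Rightarrow> 'm \<Rightarrow> 'm"
  stalk :: "'f set \<Rightarrow> 'm set"

definition local_generator :: "('f::field, 'm::ab_group_add) line_bundle \<Rightarrow> 'f set \<Rightarrow> 'm \<Rightarrow> bool" where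
  "local_generator M P u \<longleftrightarrow> u \<noteq> 0 \<and> stalk M P = (\<lambda>a. fscale M a u) ` P"

definition is_line_bundle ::
  "('k::field \<Rightarrow> 'f::field) \<Rightarrow> ('f, 'm::ab_group_add) line_bundle \<Rightarrow> bool" where
  "is_line_bundle \<iota> M \<longleftrightarrow>
     vector_space (fscale M) \<and>
     (\<exists>m. m \<noteq> 0 \<and> range (\<lambda>a. fscale M a m) = UNIV) \<and>
     (\<forall>P\<in>closed_points \<iota>. \<exists>u. local_generator M P u) \<and>
     (\<forall>m. m \<noteq> 0 \<longrightarrow> finite {P \<in> closed_points \<iota>. \<not> local_generator M P m})"

text \<open>
  A meromorphic section \<open>s\<close> of the power \<open>M\<^sup>n\<close>, for an integer \<open>n\<close>, is represented by its coordinates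
  \<open>u \<mapsto> s / u\<^sup>n\<close> with respect to the generators \<open>u\<^sup>n\<close>, where \<open>u\<close> runs over the nonzero
  meromorphic sections of \<open>M\<close>. Products and quotients of sections of powers are then pointwise, and
  \<open>coordinate M m\<close> is the section \<open>m\<close> of \<open>M\<close> itself, viewed as a section of the first power.
\<close>

definition power_sections :: "('f::field, 'm::ab_group_add) line_bundle \<Rightarrow> int \<Rightarrow> ('m \<Rightarrow> 'f) set" where
  "power_sections M n = {s. s 0 = 0 \<and>
     (\<forall>u a. u \<noteq> 0 \<longrightarrow> a \<noteq> 0 \<longrightarrow> s (fscale M a u) = a powi (- n) * s u)}"

definition coordinate :: "('f::field, 'm::ab_group_add) line_bundle \<Rightarrow> 'm \<Rightarrow> 'm \<Rightarrow> 'f" where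
  "coordinate M m u = (if u = 0 then 0 else (THE c. m = fscale M c u))"

definition ord_section :: "('f::field, 'm::ab_group_add) line_bundle \<Rightarrow> 'f set \<Rightarrow> ('m \<Rightarrow> 'f) \<Rightarrow> int" where
  "ord_section M P s = (THE k. \<exists>u. local_generator M P u \<and> k = ord_at P (s u))"

definition section_div ::
  "('k::field \<Rightarrow> 'f::field) \<Rightarrow> ('f, 'm::ab_group_add) line_bundle \<Rightarrow> ('m \<Rightarrow> 'f) \<Rightarrow> 'f divisor" where
  "section_div \<iota> M s =
    Abs_poly_mapping (\<lambda>P. if P \<in> closed_points \<iota> then ord_section M P s else 0)"

definition order_zero_at ::
  "('f::field, 'm::ab_group_add) line_bundle \<Rightarrow> 'f set \<Rightarrow> ('m \<Rightarrow> 'f) \<Rightarrow> bool" where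
  "order_zero_at M P s \<longleftrightarrow> (\<forall>u. local_generator M P u \<longrightarrow> s u \<in> units_at P)"

text \<open>\<open>H\<^sup>0(C, M\<^sup>n)\<close>\<close>
definition global_sections ::
  "('k::field \<Rightarrow> 'f::field) \<Rightarrow> ('f, 'm::ab_group_add) line_bundle \<Rightarrow> int \<Rightarrow> ('m \<Rightarrow> 'f) set" where
  "global_sections \<iota> M n = {s \<in> power_sections M n.
     \<forall>P\<in>closed_points \<iota>. \<forall>u. local_generator M P u \<longrightarrow> s u \<in> P}"

text \<open>The rational function \<open>a / b\<close>, for two sections \<open>a\<close> and \<open>b \<noteq> 0\<close> of the same power.\<close>
definition section_ratio :: "('m::ab_group_add \<Rightarrow> 'f::field) \<Rightarrow> ('m \<Rightarrow> 'f) \<Rightarrow> 'f" where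
  "section_ratio a b = (THE c. \<forall>u. u \<noteq> 0 \<longrightarrow> a u = c * b u)"

definition has_degree ::
  "('k::field \<Rightarrow> 'f::field) \<Rightarrow> ('f, 'm::ab_group_add) line_bundle \<Rightarrow> int \<Rightarrow> bool" where
  "has_degree \<iota> M \<delta> \<longleftrightarrow>
    (\<forall>m. m \<noteq> 0 \<longrightarrow> div_degree \<iota> (section_div \<iota> M (coordinate M m)) = \<delta>)"

text \<open>
  A trivialisation of \<open>M\<close> at a rational point \<open>P\<close> is a generator \<open>\<tau>\<close> of the stalk; it trivialises the
  \<open>n\<close>-th power by \<open>\<tau>\<^sup>n\<close>, so that the value at \<open>P\<close> of a section \<open>h\<close> is the value of its coordinate \<open>h \<tau>\<close>.
\<close>
definition section_value ::
  "('k::field \<Rightarrow> 'f::field) \<Rightarrow> 'f set \<Rightarrow> 'm \<Rightarrow> ('m \<Rightarrow> 'f) \<Rightarrow> 'k" where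
  "section_value \<iota> P \<tau> h = value_at \<iota> P (h \<tau>)"

definition O_div :: "'f::field divisor \<Rightarrow> ('f, 'f) line_bundle" where
  "O_div E = \<lparr>fscale = (*), stalk = (\<lambda>P. {h. h = 0 \<or> - Poly_Mapping.lookup E P \<le> ord_at P h})\<rparr>"


section \<open>Norms\<close>

text \<open>
  For a one-dimensional \<open>\<kappa>\<close>-space \<open>V\<close>, the space \<open>Norm\<^bsub>\<kappa>/K\<^esub>(V)\<close> is obtained from \<open>V - {0}\<close> by
  pushing out along the norm \<open>\<kappa>\<^sup>\<times> \<rightarrow> K\<^sup>\<times>\<close>; we represent its elements by their coordinates with respect
  to the basis vectors \<open>Norm(v)\<close>, \<open>0 \<noteq> v \<in> V\<close>. Likewise an element of the tensor product \<open>N\<^sub>F(M)\<close> is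
  given by its coordinates with respect to all bases coming from families \<open>u\<close> of generators of \<open>M\<close> at
  the points \<open>P\<close> of the support of \<open>F\<close>. Such a coordinate depends only on the images of the \<open>u P\<close> in the
  fibres of \<open>M\<close>, as two generators with the same image differ by a unit congruent to \<open>1\<close>.
\<close>

definition frame_along :: "'f::field divisor \<Rightarrow> ('f, 'm::ab_group_add) line_bundle \<Rightarrow> ('f set \<Rightarrow> 'm) \<Rightarrow> bool" where
  "frame_along F M u \<longleftrightarrow> (\<forall>P\<in>Poly_Mapping.keys F. local_generator M P (u P))"

definition norm_space ::
  "('k::field \<Rightarrow> 'f::field) \<Rightarrow> 'f divisor \<Rightarrow> ('f, 'm::ab_group_add) line_bundle \<Rightarrow> (('f set \<Rightarrow> 'm) \<Rightarrow> 'k) set" where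
  "norm_space \<iota> F M = {\<phi>.
     (\<forall>u. \<not> frame_along F M u \<longrightarrow> \<phi> u = 0) \<and>
     (\<forall>u a. frame_along F M u \<longrightarrow> (\<forall>P\<in>Poly_Mapping.keys F. a P \<in> units_at P) \<longrightarrow>
        \<phi> (\<lambda>P. fscale M (a P) (u P)) =
          (\<Prod>P\<in>Poly_Mapping.keys F. residue_norm \<iota> P (a P) powi (- Poly_Mapping.lookup F P)) * \<phi> u)}"

text \<open>\<open>N\<^sub>F(s)\<close>, for a meromorphic section \<open>s\<close> regular and non-vanishing around the support of \<open>F\<close>.\<close>
definition section_norm ::
  "('k::field \<Rightarrow> 'f::field) \<Rightarrow> 'f divisor \<Rightarrow> ('f, 'm::ab_group_add) line_bundle \<Rightarrow> 'm \<Rightarrow> ('f set \<Rightarrow> 'm) \<Rightarrow> 'k" where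
  "section_norm \<iota> F M s = (\<lambda>u. if frame_along F M u
     then (\<Prod>P\<in>Poly_Mapping.keys F.
       residue_norm \<iota> P (coordinate M s (u P)) powi Poly_Mapping.lookup F P)
     else 0)"

text \<open>The map \<open>N\<^sub>F(M) \<rightarrow> N\<^sub>F(M')\<close> induced by an isomorphism \<open>\<alpha> : M \<rightarrow> M'\<close>.\<close>
definition norm_map :: "('m \<Rightarrow> 'm') \<Rightarrow> (('f set \<Rightarrow> 'm) \<Rightarrow> 'k) \<Rightarrow> (('f set \<Rightarrow> 'm') \<Rightarrow> 'k)" where
  "norm_map \<alpha> \<phi> = (\<lambda>u. \<phi> (\<lambda>P. inv_into UNIV \<alpha> (u P)))"


section \<open>The Poincare torsor\<close>

text \<open>
  A nonzero element \<open>\<phi>\<close> of \<open>N\<^sub>D(O(E))\<close>, with \<open>D\<close> and \<open>E\<close> of degree \<open>0\<close>, is recorded as \<open>(D, E, \<phi>)\<close>.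
  The two rules of \<open>poincare_step\<close> are the identifications between the spaces \<open>N\<^sub>D(O(E))\<close> for different
  choices of \<open>D\<close> and \<open>E\<close> in their classes; points of the torsor are classes for the generated
  equivalence relation.
\<close>

type_synonym ('k, 'f) poincare_rep = "'f divisor \<times> 'f divisor \<times> (('f set \<Rightarrow> 'f) \<Rightarrow> 'k)"

definition poincare_reps :: "('k::field \<Rightarrow> 'f::field) \<Rightarrow> ('k, 'f) poincare_rep set" where
  "poincare_reps \<iota> = {(D, E, \<phi>).
     D \<in> Div0 \<iota> \<and> E \<in> Div0 \<iota> \<and> \<phi> \<in> norm_space \<iota> D (O_div E) \<and> \<phi> \<noteq> (\<lambda>_. 0)}"

inductive poincare_step ::
  "('k::field \<Rightarrow> 'f::field) \<Rightarrow> ('k, 'f) poincare_rep \<Rightarrow> ('k, 'f) poincare_rep \<Rightarrow> bool" for \<iota> where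
  second_divisor:
    "\<lbrakk>D \<in> Div0 \<iota>; E \<in> Div0 \<iota>; f \<noteq> 0;
      \<phi> \<in> norm_space \<iota> D (O_div (E + principal_div \<iota> f)); \<phi> \<noteq> (\<lambda>_. 0)\<rbrakk> \<Longrightarrow>
     poincare_step \<iota> (D, E + principal_div \<iota> f, \<phi>) (D, E, norm_map (\<lambda>h. f * h) \<phi>)"
| first_divisor:
    "\<lbrakk>D \<in> Div0 \<iota>; E \<in> Div0 \<iota>; f \<noteq> 0; s \<noteq> 0; c \<noteq> 0;
      disjoint_div (section_div \<iota> (O_div E) (coordinate (O_div E) s)) D;
      disjoint_div (section_div \<iota> (O_div E) (coordinate (O_div E) s)) (principal_div \<iota> f)\<rbrakk> \<Longrightarrow>
     poincare_step \<iota>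
       (D + principal_div \<iota> f, E,
         \<lambda>u. c * section_norm \<iota> (D + principal_div \<iota> f) (O_div E) s u)
       (D, E,
         \<lambda>u. c * (fun_at_div \<iota> f (section_div \<iota> (O_div E) (coordinate (O_div E) s)) *
                  section_norm \<iota> D (O_div E) s u))"

definition poincare_point ::
  "('k::field \<Rightarrow> 'f::field) \<Rightarrow> 'f divisor \<Rightarrow> 'f divisor \<Rightarrow> (('f set \<Rightarrow> 'f) \<Rightarrow> 'k) \<Rightarrow>
   ('k, 'f) poincare_rep set" where
  "poincare_point \<iota> D E \<phi> = {r. equivclp (poincare_step \<iota>) (D, E, \<phi>) r}"

text \<open>The fibre at a point \<open>(x, y)\<close> of \<open>J(K) \<times> J(K)\<close>, and the action of \<open>K\<^sup>\<times>\<close>.\<close>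

definition poincare_fibre ::
  "('k::field \<Rightarrow> 'f::field) \<Rightarrow> 'f divisor set \<Rightarrow> 'f divisor set \<Rightarrow> ('k, 'f) poincare_rep set set" where
  "poincare_fibre \<iota> x y = {poincare_point \<iota> D E \<phi> | D E \<phi>.
     (D, E, \<phi>) \<in> poincare_reps \<iota> \<and> div_class \<iota> D = x \<and> div_class \<iota> E = y}"

definition poincare_act :: "'k::field \<Rightarrow> ('k, 'f) poincare_rep set \<Rightarrow> ('k, 'f) poincare_rep set" where
  "poincare_act c \<pi> = {(D, E, \<lambda>u. c * \<phi> u) | D E \<phi>. (D, E, \<phi>) \<in> \<pi>}"

text \<open>The point \<open>(D, E)\<close>, for \<open>D\<close> and \<open>E\<close> of degree \<open>0\<close> with disjoint supports.\<close>
definition poincare_pair ::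
  "('k::field \<Rightarrow> 'f::field) \<Rightarrow> 'f divisor \<Rightarrow> 'f divisor \<Rightarrow> ('k, 'f) poincare_rep set" where
  "poincare_pair \<iota> D E = poincare_point \<iota> D E (section_norm \<iota> D (O_div E) 1)"

text \<open>The point \<open>[D, E]\<close> relative to the base divisors \<open>D0\<close> and \<open>E0\<close>.\<close>
definition poincare_bracket ::
  "('k::field \<Rightarrow> 'f::field) \<Rightarrow> 'f divisor \<Rightarrow> 'f divisor \<Rightarrow> 'f divisor \<Rightarrow> 'f divisor \<Rightarrow>
   ('k, 'f) poincare_rep set" where
  "poincare_bracket \<iota> D0 E0 D E = poincare_pair \<iota> (D - D0) (E - E0)"

end

theory Submission
  imports Defs "Jordan_Normal_Form.Char_Poly"
begin

text \<open>
  Write \<open>f = d\<^sub>2 d\<^sub>0 / d\<^sub>3\<close>, \<open>h = e\<^sub>2 e\<^sub>0 / e\<^sub>3\<close> and \<open>\<sigma> = e\<^sub>0 / s\<close>, so that \<open>P\<^sub>1 - P\<^sub>2 = (D - D\<^sub>0) + (f)\<close> and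
  \<open>Q\<^sub>1 - Q\<^sub>2 = (E - E\<^sub>0) + (h)\<close>. Multiplication by \<open>h\<close> moves the norm of \<open>T\<close> into \<open>O(E - E\<^sub>0)\<close>, where
  \<open>h T = G \<sigma>\<close> with \<open>G(P\<^sub>1 - P\<^sub>2) = \<mu> \<lambda>\<^sub>s\<close>. The divisor of \<open>\<sigma>\<close> as a section of \<open>O(E - E\<^sub>0)\<close> is \<open>E - (s)\<close>,
  so replacing \<open>P\<^sub>1 - P\<^sub>2\<close> by \<open>D - D\<^sub>0\<close> costs the factor \<open>f(E - (s))\<close>, and then comparing \<open>\<sigma>\<close> with the
  section \<open>1\<close> costs \<open>\<sigma>(D - D\<^sub>0)\<close>; these two factors make up \<open>\<nu>\<close>.

  That evaluation at divisors is multiplicative rests on the residue fields being finite over \<open>K\<close>,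
  which makes their norms multiplicative and independent of the basis.
\<close>

section \<open>Closed points\<close>

text \<open>The auxiliary section \<open>s\<close> is needed because the section \<open>1\<close> of
  \<open>O(E - E0)\<close> has divisor \<open>E - E0\<close>, and \<open>E0\<close> is only known to
  avoid \<open>D\<close> and \<open>D0\<close>, whereas changing the first divisor by
  \<open>(f)\<close> requires a divisor that also avoids \<open>(f)\<close>. Passing to
  \<open>\<sigma> = e0 / s\<close> exchanges \<open>E0\<close> for \<open>(s)\<close>. In
  \<open>G = h T / \<sigma>\<close> the section \<open>e0\<close> cancels, leaving a product of
  sections of weights 1, -2 and 1: a function, although each of its factors needs a trivialisation
  to be evaluated.

  Closed points are abstract valuation rings and \<open>residue_norm\<close> is a definite
  description over bases, so no property of norms is available before a finite basis of the residue
  field is known to exist. This is extracted from the finiteness of \<open>K(C)\<close> over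
  \<open>K(x)\<close> by counting dimensions. Similarly, \<open>principal_div f\<close> has the
  expected coefficients only once \<open>f\<close> is known to have finitely many zeros and poles;
  this is read off from the finiteness condition on the line bundle \<open>L\<close>, which is why
  the facts about principal divisors and the bundles \<open>O_div E\<close> are proved with
  \<open>L\<close> fixed.\<close>

locale function_field = field_hom \<iota> for \<iota> :: "'k::field \<Rightarrow> 'f::field" +
  assumes ff: "function_field_one_var \<iota>"

locale curve_point = function_field \<iota> for \<iota> :: "'k::field \<Rightarrow> 'f::field" +
  fixes P :: "'f set"
  assumes closed: "P \<in> closed_points \<iota>"
begin

lemma const_mem: "\<iota> c \<in> P"
  and add_mem: "x \<in> P \<Longrightarrow> y \<in> P \<Longrightarrow> x + y \<in> P"
  and mult_mem: "x \<in> P \<Longrightarrow> y \<in> P \<Longrightarrow> x * y \<in> P"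
  using closed by (auto simp: closed_points_def)

lemma zero_mem: "0 \<in> P" and one_mem: "1 \<in> P"
  using const_mem[of 0] const_mem[of 1] by simp_all

lemma uminus_mem: "x \<in> P \<Longrightarrow> - x \<in> P"
  using mult_mem[OF const_mem[of "- 1"]] by (simp add: hom_uminus)

lemma sum_mem: "(\<And>i. i \<in> A \<Longrightarrow> f i \<in> P) \<Longrightarrow> sum f A \<in> P"
  by (induction A rule: infinite_finite_induct) (auto intro: zero_mem add_mem)

lemma power_mem: "x \<in> P \<Longrightarrow> x ^ n \<in> P"
  by (induction n) (auto intro: one_mem mult_mem)

lemma poly_mem: "x \<in> P \<Longrightarrow> poly (map_poly \<iota> p) x \<in> P"
  by (induction p) (auto simp: zero_mem map_poly_pCons_hom intro!: add_mem mult_mem const_mem)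

lemma units_mult: "x \<in> units_at P \<Longrightarrow> y \<in> units_at P \<Longrightarrow> x * y \<in> units_at P"
  by (auto simp: units_at_def intro: mult_mem)

lemma units_inverse: "x \<in> units_at P \<Longrightarrow> inverse x \<in> units_at P"
  by (auto simp: units_at_def)

lemma units_one: "1 \<in> units_at P"
  by (auto simp: units_at_def one_mem)

lemma units_divide: "x \<in> units_at P \<Longrightarrow> y \<in> units_at P \<Longrightarrow> x / y \<in> units_at P"
  by (simp add: divide_inverse units_mult units_inverse)

lemma units_power: "x \<in> units_at P \<Longrightarrow> x ^ n \<in> units_at P"
  by (induction n) (auto intro: units_one units_mult)

lemma units_powi: "x \<in> units_at P \<Longrightarrow> x powi n \<in> units_at P"
  by (auto simp: power_int_def intro: units_power units_inverse)

lemma max_ideal_iff: "x \<in> max_ideal P \<longleftrightarrow> x \<in> P \<and> x \<notin> units_at P"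
  by (auto simp: max_ideal_def units_at_def)

lemma obtain_uniformizer:
  obtains \<pi> where "uniformizer P \<pi>" "\<And>x. x \<noteq> 0 \<Longrightarrow> \<exists>u\<in>units_at P. \<exists>n. x = u * \<pi> powi n"
  using closed by (auto simp: closed_points_def)

text \<open>\<open>max_ideal P\<close> is defined as the set of non-units; it is an ideal because it
  equals \<open>\<pi> P\<close> for a uniformizer \<open>\<pi>\<close>.\<close>

lemma max_ideal_mult: "x \<in> max_ideal P \<Longrightarrow> y \<in> P \<Longrightarrow> x * y \<in> max_ideal P"
proof -
  assume x: "x \<in> max_ideal P" and y: "y \<in> P"
  obtain \<pi> where "uniformizer P \<pi>" by (rule obtain_uniformizer)
  then have "max_ideal P = (\<lambda>x. \<pi> * x) ` P" by (simp add: uniformizer_def)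
  with x y show ?thesis by (auto simp: mult.assoc intro!: imageI mult_mem)
qed

lemma max_ideal_add: "x \<in> max_ideal P \<Longrightarrow> y \<in> max_ideal P \<Longrightarrow> x + y \<in> max_ideal P"
proof -
  assume x: "x \<in> max_ideal P" and y: "y \<in> max_ideal P"
  obtain \<pi> where "uniformizer P \<pi>" by (rule obtain_uniformizer)
  then have m: "max_ideal P = (\<lambda>x. \<pi> * x) ` P" by (simp add: uniformizer_def)
  with x y obtain a b where "x = \<pi> * a" "a \<in> P" "y = \<pi> * b" "b \<in> P" by auto
  then have "x + y = \<pi> * (a + b)" "a + b \<in> P" by (auto simp: distrib_left intro: add_mem)
  then show ?thesis using m by blast
qed

lemma zero_max_ideal: "0 \<in> max_ideal P"
  by (simp add: max_ideal_def zero_mem)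

lemma max_ideal_uminus: "x \<in> max_ideal P \<Longrightarrow> - x \<in> max_ideal P"
  using max_ideal_mult[of x "- 1"] uminus_mem[OF one_mem] by simp

lemma max_ideal_uminus_iff: "- x \<in> max_ideal P \<longleftrightarrow> x \<in> max_ideal P"
  using max_ideal_uminus[of x] max_ideal_uminus[of "- x"] by auto

lemma max_ideal_diff: "x \<in> max_ideal P \<Longrightarrow> y \<in> max_ideal P \<Longrightarrow> x - y \<in> max_ideal P"
  using max_ideal_add[of x "- y"] max_ideal_uminus by simp

lemma max_ideal_sum: "(\<And>i. i \<in> A \<Longrightarrow> f i \<in> max_ideal P) \<Longrightarrow> sum f A \<in> max_ideal P"
  by (induction A rule: infinite_finite_induct) (auto intro: zero_max_ideal max_ideal_add)

text \<open>The inverse of a nonzero constant is a constant, so \<open>K\<close> embeds in the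
  residue field; this makes values at rational points unique.\<close>

lemma const_max_ideal_iff: "\<iota> c \<in> max_ideal P \<longleftrightarrow> c = 0"
proof -
  have "c \<noteq> 0 \<Longrightarrow> \<iota> c \<in> units_at P"
    using const_mem[of c] const_mem[of "inverse c"] by (simp add: units_at_def hom_inverse)
  then show ?thesis using zero_max_ideal by (auto simp: max_ideal_iff)
qed

text \<open>Positive powers of \<open>\<pi>\<close> stay in the maximal ideal, and negative powers
  are inverses of such elements.\<close>

lemma uniformizer_powi_unit:
  assumes "uniformizer P \<pi>" "\<pi> powi n \<in> units_at P"
  shows "n = 0"
proof -
  have m: "\<pi> \<in> max_ideal P" using assms(1) one_mem by (force simp: uniformizer_def)
  have pos: False if "k > 0" "\<pi> ^ k \<in> units_at P" for k
  proof -
    have "\<pi> ^ k = \<pi> * \<pi> ^ (k - 1)" using that(1) by (cases k) auto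
    then have "\<pi> ^ k \<in> max_ideal P"
      using max_ideal_mult[OF m power_mem[of \<pi> "k - 1"]] m by (simp add: max_ideal_iff)
    with that(2) show False by (simp add: max_ideal_iff)
  qed
  show ?thesis
  proof (cases n "0 :: int" rule: linorder_cases)
    case less
    then have "inverse (\<pi> ^ nat (- n)) \<in> units_at P" using assms(2) by (simp add: power_int_def power_inverse)
    then have "\<pi> ^ nat (- n) \<in> units_at P" using units_inverse by fastforce
    with pos[of "nat (- n)"] less show ?thesis by auto
  next
    case greater
    with pos[of "nat n"] assms(2) show ?thesis by (simp add: power_int_def)
  qed simp
qed

text \<open>\<open>ord_at\<close> is a definite description ranging over all uniformizers, so
  uniqueness has to compare two of them: both generate the maximal ideal, hence their quotient is a
  unit and the exponents agree.\<close>

lemma ord_at_eqI: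
  assumes \<pi>: "uniformizer P \<pi>" and u: "u \<in> units_at P" and x: "x = u * \<pi> powi n"
  shows "ord_at P x = n"
  unfolding ord_at_def
proof (rule the_equality)
  show "\<exists>\<pi> u. uniformizer P \<pi> \<and> u \<in> units_at P \<and> x = u * \<pi> powi n" using assms by blast
next
  fix m assume "\<exists>\<pi> u. uniformizer P \<pi> \<and> u \<in> units_at P \<and> x = u * \<pi> powi m"
  then obtain \<rho> w where \<rho>: "uniformizer P \<rho>" and w: "w \<in> units_at P" and xw: "x = w * \<rho> powi m"
    by blast
  have quot: "a / b \<in> P" if a: "uniformizer P a" and b: "uniformizer P b" for a b
  proof -
    have "a \<in> max_ideal P" using a one_mem by (force simp: uniformizer_def)
    then obtain z where "a = b * z" "z \<in> P" using b by (auto simp: uniformizer_def)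
    then show ?thesis using b by (auto simp: uniformizer_def)
  qed
  have nz: "\<pi> \<noteq> 0" "\<rho> \<noteq> 0" "u \<noteq> 0" "w \<noteq> 0"
    using \<pi> \<rho> u w by (auto simp: uniformizer_def units_at_def)
  have e: "\<rho> / \<pi> \<in> units_at P"
    using quot[OF \<pi> \<rho>] quot[OF \<rho> \<pi>] nz by (auto simp: units_at_def)
  have "u * \<pi> powi n = w * ((\<rho> / \<pi>) powi m * \<pi> powi m)"
    using x xw nz by (simp add: power_int_divide_distrib)
  then have "\<pi> powi (n - m) = w * (\<rho> / \<pi>) powi m / u"
    using nz by (simp add: power_int_diff field_simps)
  also have "\<dots> \<in> units_at P" by (intro units_divide units_mult units_powi u w e)
  finally show "m = n" using uniformizer_powi_unit[OF \<pi>, of "n - m"] by simp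
qed

text \<open>The last clause lets the same uniformizer serve all nonzero elements, which is what a
  comparison of orders of products needs.\<close>

lemma obtain_ord:
  assumes "x \<noteq> 0"
  obtains \<pi> u where "uniformizer P \<pi>" "u \<in> units_at P" "x = u * \<pi> powi ord_at P x"
    "\<And>y. y \<noteq> 0 \<Longrightarrow> \<exists>u\<in>units_at P. y = u * \<pi> powi ord_at P y"
proof -
  obtain \<pi> where \<pi>: "uniformizer P \<pi>" "\<And>x. x \<noteq> 0 \<Longrightarrow> \<exists>u\<in>units_at P. \<exists>n. x = u * \<pi> powi n"
    using obtain_uniformizer by blast
  have "\<exists>u\<in>units_at P. y = u * \<pi> powi ord_at P y" if "y \<noteq> 0" for y
    using \<pi>(2)[OF that] ord_at_eqI[OF \<pi>(1)] by metis
  with \<pi> assms show ?thesis using that by blast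
qed

lemma ord_mult:
  assumes "x \<noteq> 0" "y \<noteq> 0"
  shows "ord_at P (x * y) = ord_at P x + ord_at P y"
proof -
  obtain \<pi> u where \<pi>: "uniformizer P \<pi>" "u \<in> units_at P" "x = u * \<pi> powi ord_at P x"
    "\<And>y. y \<noteq> 0 \<Longrightarrow> \<exists>u\<in>units_at P. y = u * \<pi> powi ord_at P y"
    using obtain_ord[OF assms(1)] by metis
  obtain w where w: "w \<in> units_at P" "y = w * \<pi> powi ord_at P y" using \<pi>(4) assms(2) by blast
  have "\<pi> \<noteq> 0" using \<pi>(1) by (simp add: uniformizer_def)
  then have "x * y = (u * w) * \<pi> powi (ord_at P x + ord_at P y)"
    by (subst \<pi>(3), subst w(2)) (simp add: power_int_add)
  then show ?thesis using ord_at_eqI[OF \<pi>(1) units_mult[OF \<pi>(2) w(1)]] by blast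
qed

lemma ord_unit_iff: "x \<in> units_at P \<longleftrightarrow> x \<noteq> 0 \<and> ord_at P x = 0"
proof
  assume x: "x \<in> units_at P"
  obtain \<pi> where "uniformizer P \<pi>" by (rule obtain_uniformizer)
  from ord_at_eqI[OF this x, of x 0] x show "x \<noteq> 0 \<and> ord_at P x = 0"
    by (simp add: units_at_def)
next
  assume x: "x \<noteq> 0 \<and> ord_at P x = 0"
  then obtain \<pi> u where "u \<in> units_at P" "x = u * \<pi> powi ord_at P x"
    using obtain_ord by metis
  with x show "x \<in> units_at P" by simp
qed

lemma ord_one: "ord_at P 1 = 0"
  using units_one ord_unit_iff by blast

lemma ord_inverse: "x \<noteq> 0 \<Longrightarrow> ord_at P (inverse x) = - ord_at P x"
  using ord_mult[of x "inverse x"] ord_one by simp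

lemma ord_divide: "x \<noteq> 0 \<Longrightarrow> y \<noteq> 0 \<Longrightarrow> ord_at P (x / y) = ord_at P x - ord_at P y"
  by (simp add: divide_inverse ord_mult ord_inverse)

text \<open>An element of \<open>P\<close> of negative order would have its inverse in
  \<open>P\<close> as well, and so be a unit, of order 0.\<close>

lemma ord_nonneg_iff:
  assumes "x \<noteq> 0"
  shows "x \<in> P \<longleftrightarrow> 0 \<le> ord_at P x"
proof -
  obtain \<pi> u where \<pi>: "uniformizer P \<pi>" "u \<in> units_at P" "x = u * \<pi> powi ord_at P x"
    using obtain_ord[OF assms] by metis
  have "\<pi> \<in> max_ideal P" using \<pi>(1) one_mem by (force simp: uniformizer_def)
  then have m: "\<pi> \<in> P" by (simp add: max_ideal_iff)
  have uP: "u \<in> P" "u \<noteq> 0" using \<pi>(2) by (auto simp: units_at_def)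
  have n: "y \<in> P" if "y = w * \<pi> powi n" "w \<in> P" "0 \<le> n" for y w n
    using that power_mem[OF m] by (auto simp: power_int_def intro!: mult_mem)
  show ?thesis
  proof
    assume "x \<in> P"
    show "0 \<le> ord_at P x"
    proof (rule ccontr)
      assume neg: "\<not> 0 \<le> ord_at P x"
      have "inverse x = inverse u * \<pi> powi (- ord_at P x)"
        by (subst \<pi>(3)) (simp add: power_int_minus)
      then have "inverse x \<in> P" using n[of "inverse x" "inverse u"] neg units_inverse[OF \<pi>(2)]
        by (simp add: units_at_def)
      with \<open>x \<in> P\<close> assms have "x \<in> units_at P" by (simp add: units_at_def)
      with neg show False by (simp add: ord_unit_iff)
    qed
  next
    assume "0 \<le> ord_at P x"
    with n[OF \<pi>(3) uP(1)] show "x \<in> P" by blast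
  qed
qed

lemma inverse_max_ideal:
  assumes "x \<notin> P"
  shows "inverse x \<in> max_ideal P" "x \<noteq> 0"
proof -
  show "x \<noteq> 0" using assms zero_mem by auto
  then show "inverse x \<in> max_ideal P"
    using assms ord_nonneg_iff[of x] ord_nonneg_iff[of "inverse x"] ord_inverse[of x]
      ord_unit_iff[of "inverse x"] by (auto simp: max_ideal_iff)
qed


end

text \<open>The coefficient matrix is padded with zero rows to a square one. Row number
  \<open>card I\<close> exists since \<open>card I < card J\<close>; being zero, it kills the
  determinant and yields a kernel vector.\<close>

lemma homogeneous_system_nontrivial:
  fixes A :: "'i \<Rightarrow> 'j \<Rightarrow> 'k::field"
  assumes I: "finite I" and J: "finite J" and less: "card I < card J"
  shows "\<exists>c. (\<exists>j\<in>J. c j \<noteq> 0) \<and> (\<forall>i\<in>I. (\<Sum>j\<in>J. A i j * c j) = 0)"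
proof -
  define n where "n = card J"
  obtain f where f: "bij_betw f {0..<card I} I" using I ex_bij_betw_nat_finite by blast
  obtain h where h: "bij_betw h {0..<n} J" using J ex_bij_betw_nat_finite n_def by blast
  define row where "row i = vec n (\<lambda>j. if i < card I then A (f i) (h j) else 0)" for i
  define M where "M = mat\<^sub>r n n (\<lambda>i. if i = card I then 0\<^sub>v n else row i)"
  have M: "M \<in> carrier_mat n n" by (simp add: M_def)
  have "det M = 0" unfolding M_def
    by (rule det_row_0) (use less in \<open>auto simp: row_def n_def\<close>)
  then obtain v where v: "v \<in> carrier_vec n" "v \<noteq> 0\<^sub>v n" "M *\<^sub>v v = 0\<^sub>v n"
    using det_0_iff_vec_prod_zero_field[OF M] by blast
  obtain k where k: "k < n" "v $ k \<noteq> 0"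
    using v(1,2) by (metis carrier_vecD eq_vecI index_zero_vec)
  define c where "c j = v $ the_inv_into {0..<n} h j" for j
  have ch: "c (h k) = v $ k" if "k < n" for k
    using h that by (simp add: c_def bij_betw_def the_inv_into_f_f)
  have "(\<Sum>j\<in>J. A i j * c j) = 0" if "i \<in> I" for i
  proof -
    obtain i' where i': "i = f i'" "i' < card I"
      using f \<open>i \<in> I\<close> by (metis atLeastLessThan_iff bij_betw_def imageE)
    have "(\<Sum>j\<in>J. A i j * c j) = (\<Sum>k\<in>{0..<n}. A i (h k) * c (h k))"
      by (rule sum.reindex_bij_betw[OF h, symmetric])
    also have "\<dots> = (M *\<^sub>v v) $ i'"
      using i' less v(1) ch by (auto simp: M_def row_def n_def scalar_prod_def intro!: sum.cong)
    also have "\<dots> = 0" using v(3) i' less by (simp add: n_def)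
    finally show ?thesis .
  qed
  moreover have "h k \<in> J" using h k(1) by (auto simp: bij_betw_def)
  moreover have "c (h k) \<noteq> 0" using k ch by simp
  ultimately show ?thesis by blast
qed

section \<open>Finiteness of the residue fields\<close>

context field_hom
begin

lemma poly_map_add: "poly (map_poly hom (p + q)) x = poly (map_poly hom p) x + poly (map_poly hom q) x"
  and poly_map_smult: "poly (map_poly hom (smult c p)) x = hom c * poly (map_poly hom p) x"
  and poly_map_monom: "poly (map_poly hom (monom c n)) x = hom c * x ^ n"
  by (simp_all add: hom_distribs map_poly_monom poly_monom)

lemma poly_map_mult: "poly (map_poly hom (p * q)) x = poly (map_poly hom p) x * poly (map_poly hom q) x"
  by (induction p) (simp_all add: poly_map_add poly_map_smult map_poly_pCons_hom distrib_right mult.assoc)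

lemma poly_map_power: "poly (map_poly hom (p ^ n)) x = poly (map_poly hom p) x ^ n"
  by (induction n) (simp_all add: poly_map_mult)

lemma poly_map_sum: "poly (map_poly hom (\<Sum>i\<in>A. p i)) x = (\<Sum>i\<in>A. poly (map_poly hom (p i)) x)"
  by (induction A rule: infinite_finite_induct) (simp_all add: poly_map_add)

lemma common_denominator:
  fixes p q :: "'i \<Rightarrow> 'a poly"
  assumes I: "finite I"
  shows "\<exists>Q R. Q \<noteq> 0 \<and> (\<forall>i\<in>I. poly (map_poly hom Q) x *
      (poly (map_poly hom (p i)) x / poly (map_poly hom (q i)) x) = poly (map_poly hom (R i)) x)"
proof -
  let ?ev = "\<lambda>p. poly (map_poly hom p) x"
  \<comment> \<open>A fraction whose denominator vanishes at \<open>x\<close> has value 0 by the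
    convention for division; replacing it by \<open>0 / 1\<close> makes the product of all
    denominators usable.\<close>
  define p' where "p' i = (if ?ev (q i) = 0 then 0 else p i)" for i
  define q' where "q' i = (if ?ev (q i) = 0 then 1 else q i)" for i
  have q': "?ev (q' i) \<noteq> 0" for i by (simp add: q'_def)
  then have "q' i \<noteq> 0" for i by (metis map_poly_0 poly_0)
  then have "(\<Prod>i\<in>I. q' i) \<noteq> 0" using I by simp
  moreover have "?ev (\<Prod>i\<in>I. q' i) * (?ev (p i) / ?ev (q i)) = ?ev (p' i * (\<Prod>j\<in>I - {i}. q' j))"
    if "i \<in> I" for i
  proof -
    have "?ev (p i) / ?ev (q i) = ?ev (p' i) / ?ev (q' i)"
      by (simp add: p'_def q'_def)
    moreover have "(\<Prod>i\<in>I. q' i) = q' i * (\<Prod>j\<in>I - {i}. q' j)"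
      by (rule prod.remove[OF I that])
    ultimately show ?thesis using q'[of i] by (simp add: poly_map_mult)
  qed
  ultimately show ?thesis
    by (intro exI[of _ "\<Prod>i\<in>I. q' i"] exI[of _ "\<lambda>i. p' i * (\<Prod>j\<in>I - {i}. q' j)"]) simp
qed

text \<open>The coefficients are found by counting: after clearing denominators, the elements
  \<open>y\<^sup>j a\<^sub>i\<close> with \<open>j < N\<close> lie in a \<open>K\<close>-space of dimension at most \<open>|B| (N deg p + O(1))\<close>.\<close>
lemma polynomial_relation:
  assumes transc: "\<forall>p. p \<noteq> 0 \<longrightarrow> poly (map_poly hom p) x \<noteq> 0"
    and B: "finite B"
    and span: "\<And>f. \<exists>p q. f = (\<Sum>b\<in>B. poly (map_poly hom (p b)) x / poly (map_poly hom (q b)) x * b)"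
    and y: "y = poly (map_poly hom p) x"
    and r: "card B * degree p < r"
  shows "\<exists>N c. (\<exists>i<r. \<exists>j<N. c i j \<noteq> 0) \<and> (\<Sum>i<r. \<Sum>j<N. hom (c i j) * y ^ j * a i) = 0"
proof -
  let ?ev = "\<lambda>p. poly (map_poly hom p) x"
  have "\<forall>i. \<exists>pq. a i = (\<Sum>b\<in>B. ?ev (fst pq b) / ?ev (snd pq b) * b)"
  proof
    fix i
    obtain p q where "a i = (\<Sum>b\<in>B. ?ev (p b) / ?ev (q b) * b)" using span by blast
    then show "\<exists>pq. a i = (\<Sum>b\<in>B. ?ev (fst pq b) / ?ev (snd pq b) * b)"
      by (intro exI[of _ "(p, q)"]) simp
  qed
  from choice[OF this] obtain w where "\<forall>i. a i = (\<Sum>b\<in>B. ?ev (fst (w i) b) / ?ev (snd (w i) b) * b)"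
    by blast
  then obtain u v where uv: "\<And>i. a i = (\<Sum>b\<in>B. ?ev (u i b) / ?ev (v i b) * b)"
    by (rule_tac that[of "fst \<circ> w" "snd \<circ> w"]) simp
  obtain Q R where Q: "Q \<noteq> 0" and R: "\<And>i b. i < r \<Longrightarrow> b \<in> B \<Longrightarrow>
      ?ev Q * (?ev (u i b) / ?ev (v i b)) = ?ev (R i b)"
    using common_denominator[of "{..<r} \<times> B" x "\<lambda>(i, b). u i b" "\<lambda>(i, b). v i b"] B
    by (auto simp: case_prod_unfold)
  have Qa: "?ev Q * a i = (\<Sum>b\<in>B. ?ev (R i b) * b)" if "i < r" for i
    unfolding uv sum_distrib_left
    by (intro sum.cong refl) (simp only: R[OF that] flip: mult.assoc)
  define e where "e = Max (insert 0 ((\<lambda>(i, b). degree (R i b)) ` ({..<r} \<times> B)))"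
  have e: "degree (R i b) \<le> e" if "i < r" "b \<in> B" for i b
    unfolding e_def using that B by (intro Max_ge) auto
  \<comment> \<open>There are \<open>r * N\<close> unknowns and
    \<open>card B * (e + degree p * N + 1)\<close> equations. As \<open>r\<close> is at least
    \<open>card B * degree p + 1\<close>, the unknowns win as soon as \<open>N\<close> exceeds
    \<open>card B * (e + 1)\<close>.\<close>
  define N where "N = card B * (e + 1) + 1"
  define m where "m = e + degree p * N"
  have "card ({..m} \<times> B) < card ({..<r} \<times> {..<N})"
  proof -
    have "card ({..m} \<times> B) = card B * degree p * N + card B * (e + 1)"
      by (simp add: card_cartesian_product m_def algebra_simps)
    also have "\<dots> < card B * degree p * N + N" by (simp add: N_def)
    also have "\<dots> = (card B * degree p + 1) * N" by (simp add: algebra_simps)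
    also have "\<dots> \<le> r * N" using r by (intro mult_right_mono) auto
    finally show ?thesis by (simp add: card_cartesian_product)
  qed
  \<comment> \<open>The unknowns are the \<open>c ij\<close>. For each \<open>b\<close>, the
    equations annihilate the coefficients up to degree \<open>m\<close> of the polynomial in
    \<open>x\<close> that multiplies \<open>b\<close>; higher coefficients vanish for degree
    reasons.\<close>
  then obtain c where c0: "\<exists>j\<in>{..<r} \<times> {..<N}. c j \<noteq> 0"
    and c: "\<And>kb. kb \<in> {..m} \<times> B \<Longrightarrow> (\<Sum>ij\<in>{..<r} \<times> {..<N}.
      coeff (R (fst ij) (snd kb) * p ^ snd ij) (fst kb) * c ij) = 0"
    using homogeneous_system_nontrivial[of "{..m} \<times> B" "{..<r} \<times> {..<N}"
      "\<lambda>kb ij. coeff (R (fst ij) (snd kb) * p ^ snd ij) (fst kb)"] B by blast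
  have S: "(\<Sum>ij\<in>{..<r} \<times> {..<N}. smult (c ij) (R (fst ij) b * p ^ snd ij)) = 0" if "b \<in> B" for b
  proof (rule poly_eqI)
    fix k
    have "coeff (R i b * p ^ j) k = 0" if "k > m" "i < r" "j < N" for i j
    proof (rule coeff_eq_0)
      have "degree (R i b * p ^ j) \<le> degree (R i b) + degree p * j"
        using degree_mult_le[of "R i b" "p ^ j"] degree_power_le[of p j] by linarith
      also have "\<dots> \<le> m" unfolding m_def
        using e[OF \<open>i < r\<close> \<open>b \<in> B\<close>] \<open>j < N\<close> by (intro add_mono mult_left_mono) auto
      finally show "degree (R i b * p ^ j) < k" using \<open>k > m\<close> by simp
    qed
    then show "coeff (\<Sum>ij\<in>{..<r} \<times> {..<N}. smult (c ij) (R (fst ij) b * p ^ snd ij)) k = coeff 0 k"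
      using c[of "(k, b)"] \<open>b \<in> B\<close>
      by (cases "k \<le> m") (auto simp: coeff_sum mult.commute intro!: sum.neutral)
  qed
  have "?ev Q * (\<Sum>i<r. \<Sum>j<N. hom (c (i, j)) * y ^ j * a i)
      = (\<Sum>ij\<in>{..<r} \<times> {..<N}. hom (c ij) * y ^ snd ij * (?ev Q * a (fst ij)))"
    by (simp add: sum.cartesian_product sum_distrib_left case_prod_unfold mult_ac)
  also have "\<dots> = (\<Sum>ij\<in>{..<r} \<times> {..<N}. \<Sum>b\<in>B. ?ev (smult (c ij) (R (fst ij) b * p ^ snd ij)) * b)"
  proof (intro sum.cong refl)
    fix ij assume "ij \<in> {..<r} \<times> {..<N}"
    then have "fst ij < r" by auto
    from Qa[OF this] show "hom (c ij) * y ^ snd ij * (?ev Q * a (fst ij)) =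
        (\<Sum>b\<in>B. ?ev (smult (c ij) (R (fst ij) b * p ^ snd ij)) * b)"
      by (simp only: y poly_map_mult poly_map_smult poly_map_power sum_distrib_left mult_ac)
  qed
  also have "\<dots> = (\<Sum>b\<in>B. ?ev (\<Sum>ij\<in>{..<r} \<times> {..<N}. smult (c ij) (R (fst ij) b * p ^ snd ij)) * b)"
    by (subst sum.swap) (simp add: poly_map_sum sum_distrib_right)
  also have "\<dots> = 0" by (simp add: S)
  finally have "(\<Sum>i<r. \<Sum>j<N. hom (c (i, j)) * y ^ j * a i) = 0" using transc Q by simp
  with c0 show ?thesis by (intro exI[of _ N] exI[of _ "\<lambda>i j. c (i, j)"]) auto
qed

end

context curve_point
begin

text \<open>Linear independence over \<open>K\<close> of the residue classes. Indexing by an initial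
  segment of the naturals lets a family be extended by \<open>a(r := x)\<close>.\<close>

definition residue_independent :: "nat \<Rightarrow> (nat \<Rightarrow> 'f) \<Rightarrow> bool" where
  "residue_independent r a \<longleftrightarrow> (\<forall>i<r. a i \<in> P) \<and>
    (\<forall>c. (\<Sum>i<r. \<iota> (c i) * a i) \<in> max_ideal P \<longrightarrow> (\<forall>i<r. c i = 0))"

lemma residue_independentD:
  "residue_independent r a \<Longrightarrow> (\<Sum>i<r. \<iota> (c i) * a i) \<in> max_ideal P \<Longrightarrow> i < r \<Longrightarrow> c i = 0"
  by (simp add: residue_independent_def)

text \<open>Independence over \<open>K\<close> modulo the maximal ideal lifts to independence over
  \<open>K[y]\<close>: reducing a relation kills the coefficients of \<open>y ^ 0\<close>, then one
  factor \<open>y\<close> can be cancelled and the induction continues.\<close>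

lemma residue_independent_powers:
  assumes a: "residue_independent r a" and y: "y \<in> max_ideal P" "y \<noteq> 0"
    and c: "(\<Sum>i<r. \<Sum>j<N. \<iota> (c i j) * y ^ j * a i) = 0" and ij: "i < r" "j < N"
  shows "c i j = 0"
  using c ij
proof (induction N arbitrary: c i j)
  case (Suc N)
  let ?S = "\<Sum>i<r. \<Sum>j<N. \<iota> (c i (Suc j)) * y ^ j * a i"
  have "(\<Sum>i<r. \<Sum>j<Suc N. \<iota> (c i j) * y ^ j * a i) = (\<Sum>i<r. \<iota> (c i 0) * a i) + y * ?S"
    by (simp only: sum.lessThan_Suc_shift sum.distrib sum_distrib_left) (simp add: mult_ac)
  with Suc.prems(1) have eq: "(\<Sum>i<r. \<iota> (c i 0) * a i) = - (y * ?S)"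
    by (simp add: eq_neg_iff_add_eq_0)
  have "y \<in> P" using y(1) by (simp add: max_ideal_iff)
  then have "?S \<in> P" using a
    by (intro sum_mem mult_mem const_mem power_mem) (auto simp: residue_independent_def)
  then have "(\<Sum>i<r. \<iota> (c i 0) * a i) \<in> max_ideal P"
    unfolding eq using y(1) by (intro max_ideal_uminus max_ideal_mult)
  from residue_independentD[OF a this] have c0: "\<forall>i<r. c i 0 = 0" by blast
  then have "?S = 0" using eq y(2) by simp
  then show ?case using Suc.IH[of "\<lambda>i j. c i (Suc j)"] Suc.prems(2,3) c0 by (cases j) auto
qed simp

text \<open>The nonzero terms have pairwise distinct orders \<open>-i\<close>, so they cannot
  cancel. Concretely, after multiplication by \<open>\<pi> ^ r\<close> all terms but the last one
  lie in the maximal ideal.\<close>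

lemma unit_combination_powers:
  assumes \<pi>: "\<pi> \<in> max_ideal P" "\<pi> \<noteq> 0"
    and u: "\<And>i. i < r \<Longrightarrow> u i = 0 \<or> u i \<in> units_at P"
    and sum0: "(\<Sum>i<r. u i * inverse \<pi> ^ i) = 0" and i: "i < r"
  shows "u i = 0"
  using u sum0 i
proof (induction r arbitrary: i)
  case (Suc r)
  have \<pi>P: "\<pi> \<in> P" using \<pi>(1) by (simp add: max_ideal_iff)
  have "0 = \<pi> ^ r * (\<Sum>i<Suc r. u i * inverse \<pi> ^ i)" using Suc.prems(2) by simp
  also have "\<dots> = (\<Sum>i<r. u i * (\<pi> ^ r * inverse \<pi> ^ i)) + u r"
    using \<pi>(2) by (simp add: distrib_left sum_distrib_left mult_ac power_inverse)
  also have "(\<Sum>i<r. u i * (\<pi> ^ r * inverse \<pi> ^ i)) = (\<Sum>i<r. \<pi> * (\<pi> ^ (r - Suc i) * u i))"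
  proof (intro sum.cong refl)
    fix i assume "i \<in> {..<r}"
    then have "\<pi> ^ r = \<pi> * \<pi> ^ (r - Suc i) * \<pi> ^ i"
      by (simp flip: power_Suc power_add)
    then show "u i * (\<pi> ^ r * inverse \<pi> ^ i) = \<pi> * (\<pi> ^ (r - Suc i) * u i)"
      using \<pi>(2) by (simp add: power_inverse)
  qed
  finally have "u r = - (\<Sum>i<r. \<pi> * (\<pi> ^ (r - Suc i) * u i))" by (simp add: eq_neg_iff_add_eq_0 add.commute)
  moreover have "u i \<in> P" if "i < r" for i
    using Suc.prems(1)[of i] that zero_mem by (auto simp: units_at_def)
  ultimately have "u r \<in> max_ideal P"
    by (auto intro!: max_ideal_uminus max_ideal_sum max_ideal_mult[OF \<pi>(1)] mult_mem power_mem \<pi>P)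
  then have "u r = 0" using Suc.prems(1)[of r] by (auto simp: max_ideal_iff)
  then show ?case using Suc.IH[of i] Suc.prems by (cases "i = r") auto
qed simp

text \<open>If \<open>y\<close> in the maximal ideal is a nonzero polynomial in \<open>x\<close> or \<open>1/x\<close>, elements independent in the
  residue field stay independent over \<open>K(y)\<close>, whose index in \<open>K(C)\<close> is finite.\<close>
lemma residue_independent_bounded: "\<exists>R. \<forall>r a. residue_independent r a \<longrightarrow> r \<le> R"
proof -
  obtain x B where transc: "\<forall>p. p \<noteq> 0 \<longrightarrow> poly (map_poly \<iota> p) x \<noteq> 0" and B: "finite B"
    and span: "\<And>f. \<exists>p q. f = (\<Sum>b\<in>B. poly (map_poly \<iota> (p b)) x / poly (map_poly \<iota> (q b)) x * b)"
    using ff unfolding function_field_one_var_def by blast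
  note relation = polynomial_relation[OF transc B span]
  have x: "x = poly (map_poly \<iota> [:0, 1:]) x" by (simp add: hom_distribs)
  show ?thesis
  proof (cases "x \<in> P")
    case True
    \<comment> \<open>Otherwise the valuation is trivial on \<open>K[x]\<close>. Then the
      \<open>1 + card B\<close> powers of \<open>inverse \<pi>\<close> are independent over
      \<open>K[x]\<close>, while the counting lemma, applied to the polynomial
      \<open>[:0, 1:]\<close> of degree 1, gives a relation between them.\<close>
    have "\<exists>p. p \<noteq> 0 \<and> poly (map_poly \<iota> p) x \<in> max_ideal P"
    proof (rule ccontr)
      assume "\<not> ?thesis"
      then have unit: "p = 0 \<or> poly (map_poly \<iota> p) x \<in> units_at P" for p
        using poly_mem[OF True] by (auto simp: max_ideal_iff)
      obtain \<pi> where \<pi>: "uniformizer P \<pi>" by (rule obtain_uniformizer)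
      then have \<pi>m: "\<pi> \<in> max_ideal P" "\<pi> \<noteq> 0" using one_mem by (force simp: uniformizer_def)+
      obtain N c where c0: "\<exists>i<Suc (card B). \<exists>j<N. c i j \<noteq> 0"
        and c: "(\<Sum>i<Suc (card B). \<Sum>j<N. \<iota> (c i j) * x ^ j * inverse \<pi> ^ i) = 0"
        using relation[OF x, of "Suc (card B)" "\<lambda>i. inverse \<pi> ^ i"] by auto
      define C where "C i = (\<Sum>j<N. monom (c i j) j)" for i
      have C: "(\<Sum>j<N. \<iota> (c i j) * x ^ j) = poly (map_poly \<iota> (C i)) x" for i
        by (simp only: C_def poly_map_sum poly_map_monom)
      have "poly (map_poly \<iota> (C i)) x = 0" if "i < Suc (card B)" for i
      proof (rule unit_combination_powers[OF \<pi>m _ _ that, where u = "\<lambda>i. poly (map_poly \<iota> (C i)) x"])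
        show "poly (map_poly \<iota> (C i)) x = 0 \<or> poly (map_poly \<iota> (C i)) x \<in> units_at P" for i
          using unit[of "C i"] by auto
        show "(\<Sum>i<Suc (card B). poly (map_poly \<iota> (C i)) x * inverse \<pi> ^ i) = 0"
          using c by (simp only: C flip: sum_distrib_right)
      qed
      then have C0: "C i = 0" if "i < Suc (card B)" for i using transc that by blast
      have "coeff (C i) j = c i j" if "j < N" for i j
        using that by (simp add: C_def coeff_sum sum.delta)
      moreover obtain i j where "i < Suc (card B)" "j < N" "c i j \<noteq> 0" using c0 by blast
      ultimately show False using C0[of i] by (metis coeff_0)
    qed
    then obtain p where p: "p \<noteq> 0" "poly (map_poly \<iota> p) x \<in> max_ideal P" by blast
    have "r \<le> card B * degree p" if a: "residue_independent r a" for r a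
    proof (rule ccontr)
      assume "\<not> r \<le> card B * degree p"
      then obtain N c where "\<exists>i<r. \<exists>j<N. c i j \<noteq> 0"
        "(\<Sum>i<r. \<Sum>j<N. \<iota> (c i j) * poly (map_poly \<iota> p) x ^ j * a i) = 0"
        using relation[OF refl, of p r a] by auto
      with residue_independent_powers[OF a p(2)] transc p(1) show False by blast
    qed
    then show ?thesis by blast
  next
    case False
    have "r \<le> card B" if a: "residue_independent r a" for r a
    proof (rule ccontr)
      assume "\<not> r \<le> card B"
      then obtain N c where c0: "\<exists>i<r. \<exists>j<N. c i j \<noteq> 0"
        and c: "(\<Sum>i<r. \<Sum>j<N. \<iota> (c i j) * x ^ j * a i) = 0"
        using relation[OF x, of r a] by auto
      have nz: "x \<noteq> 0" using inverse_max_ideal[OF False] by simp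
      \<comment> \<open>The counting lemma gives a relation in powers of \<open>x\<close>, but it is
        \<open>inverse x\<close> that lies in the maximal ideal. Multiplying by
        \<open>inverse x ^ (N - 1)\<close> and reversing the order of summation turns one kind of
        relation into the other.\<close>
      have pow: "inverse x ^ (N - 1) * x ^ (N - 1 - j) = inverse x ^ j" if "j < N" for j
      proof -
        have "N - 1 = j + (N - 1 - j)" using that by simp
        then have "inverse x ^ (N - 1) = inverse x ^ j * inverse x ^ (N - 1 - j)"
          by (metis power_add)
        then show ?thesis using nz by (simp add: power_inverse)
      qed
      have "0 = inverse x ^ (N - 1) * (\<Sum>i<r. \<Sum>j<N. \<iota> (c i j) * x ^ j * a i)" using c by simp
      also have "\<dots> = (\<Sum>i<r. \<Sum>j<N. \<iota> (c i (N - Suc j)) * (inverse x ^ (N - 1) * x ^ (N - 1 - j)) * a i)"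
        by (subst sum.nat_diff_reindex[symmetric]) (simp add: sum_distrib_left mult_ac)
      also have "\<dots> = (\<Sum>i<r. \<Sum>j<N. \<iota> (c i (N - Suc j)) * inverse x ^ j * a i)"
        by (intro sum.cong refl) (simp only: pow lessThan_iff)
      finally have z: "i < r \<Longrightarrow> j < N \<Longrightarrow> c i (N - Suc j) = 0" for i j
        using residue_independent_powers[OF a inverse_max_ideal(1)[OF False], where N = N and c = "\<lambda>i j. c i (N - Suc j)"] nz
        by simp
      have "c i j = 0" if "i < r" "j < N" for i j
        using z[of i "N - Suc j"] that by simp
      with c0 show False by blast
    qed
    then show ?thesis by blast
  qed
qed

text \<open>A vanishing combination and the zero list are both coordinates of 0, and coordinates are
  unique.\<close>

lemma residue_independent_basis:
  assumes "residue_basis \<iota> P bs"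
  shows "residue_independent (length bs) (\<lambda>i. bs ! i)"
  unfolding residue_independent_def
proof (intro conjI allI impI)
  show "bs ! i \<in> P" if "i < length bs" for i
    using assms that by (auto simp: residue_basis_def quotient_basis_def)
next
  fix c i assume c: "(\<Sum>i<length bs. \<iota> (c i) * bs ! i) \<in> max_ideal P" and i: "i < length bs"
  let ?Q = "\<lambda>cs. length cs = length bs \<and> 0 - (\<Sum>i<length bs. \<iota> (cs ! i) * bs ! i) \<in> max_ideal P"
  have "\<exists>!cs. ?Q cs"
    using assms zero_mem unfolding residue_basis_def quotient_basis_def by blast
  moreover have "?Q (map c [0..<length bs])" using c by (simp add: max_ideal_uminus_iff)
  moreover have "?Q (replicate (length bs) 0)" by (simp add: zero_max_ideal)
  ultimately have "map c [0..<length bs] = replicate (length bs) 0" by blast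
  then have "map c [0..<length bs] ! i = replicate (length bs) 0 ! i" by simp
  then show "c i = 0" using i by simp
qed

text \<open>A family of maximal length, available by the bound, is a basis: adjoining any
  \<open>x\<close> creates a relation, in which the coefficient of \<open>x\<close> is nonzero, so
  it can be solved for \<open>x\<close>.\<close>

lemma residue_basis_exists: "\<exists>bs. residue_basis \<iota> P bs"
proof -
  obtain R where R: "\<And>r a. residue_independent r a \<Longrightarrow> r \<le> R" using residue_independent_bounded by blast
  have "residue_independent 0 a" for a by (simp add: residue_independent_def)
  then obtain r where r: "\<exists>a. residue_independent r a"
    and max: "\<And>r'. \<exists>a. residue_independent r' a \<Longrightarrow> r' \<le> r"
    using GreatestI_nat[of "\<lambda>r. \<exists>a. residue_independent r a" 0 R] R
      Greatest_le_nat[of "\<lambda>r. \<exists>a. residue_independent r a" _ R] by blast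
  obtain a where a: "residue_independent r a" using r by blast
  then have aP: "\<And>i. i < r \<Longrightarrow> a i \<in> P" by (simp add: residue_independent_def)
  have "\<exists>!cs. length cs = r \<and> x - (\<Sum>i<r. \<iota> (cs ! i) * a i) \<in> max_ideal P" if x: "x \<in> P" for x
  proof (rule ex_ex1I)
    have "\<not> residue_independent (Suc r) (a(r := x))" using max[of "Suc r"] by auto
    then obtain c where c: "(\<Sum>i<r. \<iota> (c i) * a i) + \<iota> (c r) * x \<in> max_ideal P" and "\<exists>i<Suc r. c i \<noteq> 0"
      using x aP by (auto simp: residue_independent_def less_Suc_eq)
    have cr: "c r \<noteq> 0"
    proof
      assume "c r = 0"
      with c a have "\<forall>i<r. c i = 0" by (auto simp: residue_independent_def)
      with \<open>c r = 0\<close> \<open>\<exists>i<Suc r. c i \<noteq> 0\<close> show False by (auto simp: less_Suc_eq)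
    qed
    have "((\<Sum>i<r. \<iota> (c i) * a i) + \<iota> (c r) * x) * \<iota> (inverse (c r)) =
        x - (\<Sum>i<r. \<iota> (- c i / c r) * a i)"
      using cr by (simp add: hom_distribs sum_distrib_left sum_distrib_right sum_negf field_simps)
    with max_ideal_mult[OF c const_mem]
    have "x - (\<Sum>i<r. \<iota> (- c i / c r) * a i) \<in> max_ideal P" by metis
    then show "\<exists>cs. length cs = r \<and> x - (\<Sum>i<r. \<iota> (cs ! i) * a i) \<in> max_ideal P"
      by (intro exI[of _ "map (\<lambda>i. - c i / c r) [0..<r]"]) simp
  next
    fix cs ds
    assume cs: "length cs = r \<and> x - (\<Sum>i<r. \<iota> (cs ! i) * a i) \<in> max_ideal P"
      and ds: "length ds = r \<and> x - (\<Sum>i<r. \<iota> (ds ! i) * a i) \<in> max_ideal P"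
    have "(\<Sum>i<r. \<iota> (cs ! i - ds ! i) * a i) \<in> max_ideal P"
      using max_ideal_diff[OF conjunct2[OF ds] conjunct2[OF cs]]
      by (simp add: hom_distribs left_diff_distrib sum_subtractf)
    from residue_independentD[OF a this] have "cs ! i = ds ! i" if "i < r" for i using that by simp
    with cs ds show "cs = ds" by (auto intro: nth_equalityI)
  qed
  with aP have "residue_basis \<iota> P (map a [0..<r])"
    by (auto simp: residue_basis_def quotient_basis_def)
  then show ?thesis by blast
qed

end

section \<open>Norms of residue classes\<close>

context curve_point
begin

text \<open>The columns of \<open>M\<close> are the coordinates of the residue classes of \<open>v 0, \<dots>, v (m - 1)\<close>.\<close>
definition residue_coords :: "'f list \<Rightarrow> 'k mat \<Rightarrow> nat \<Rightarrow> (nat \<Rightarrow> 'f) \<Rightarrow> bool" where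
  "residue_coords bs M m v \<longleftrightarrow> M \<in> carrier_mat (length bs) m \<and>
    (\<forall>j<m. v j - (\<Sum>i<length bs. \<iota> (M $$ (i, j)) * bs ! i) \<in> max_ideal P)"

lemma residue_coords_unique:
  assumes bs: "residue_basis \<iota> P bs" and M: "residue_coords bs M m v" and N: "residue_coords bs N m v"
  shows "M = N"
proof (rule eq_matI)
  fix i j assume "i < dim_row N" "j < dim_col N"
  then have i: "i < length bs" and j: "j < m" using N by (auto simp: residue_coords_def)
  have "(v j - (\<Sum>i<length bs. \<iota> (N $$ (i, j)) * bs ! i))
      - (v j - (\<Sum>i<length bs. \<iota> (M $$ (i, j)) * bs ! i)) \<in> max_ideal P"
    using M N j by (intro max_ideal_diff[of "_ - _" "_ - _"]) (auto simp: residue_coords_def)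
  then have "(\<Sum>i<length bs. \<iota> (M $$ (i, j) - N $$ (i, j)) * bs ! i) \<in> max_ideal P"
    by (simp add: hom_distribs left_diff_distrib sum_subtractf)
  from residue_independentD[OF residue_independent_basis[OF bs] this i]
  show "M $$ (i, j) = N $$ (i, j)" by simp
qed (use M N in \<open>auto simp: residue_coords_def\<close>)

lemma residue_coords_exists:
  assumes bs: "residue_basis \<iota> P bs" and v: "\<And>j. j < m \<Longrightarrow> v j \<in> P"
  obtains M where "residue_coords bs M m v"
proof -
  have "\<forall>j. \<exists>cs. j < m \<longrightarrow> v j - (\<Sum>i<length bs. \<iota> (cs ! i) * bs ! i) \<in> max_ideal P"
    using bs v unfolding residue_basis_def quotient_basis_def by blast
  from choice[OF this] obtain cs where
    "\<forall>j. j < m \<longrightarrow> v j - (\<Sum>i<length bs. \<iota> (cs j ! i) * bs ! i) \<in> max_ideal P" by blast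
  then have "residue_coords bs (mat (length bs) m (\<lambda>(i, j). cs j ! i)) m v"
    by (simp add: residue_coords_def)
  then show ?thesis by (rule that)
qed

text \<open>Matrix multiplication in coordinates. It serves both for changes of basis and for
  composing multiplication maps.\<close>

lemma residue_coords_compose:
  assumes M: "residue_coords bs M m v" and N: "N \<in> carrier_mat m k"
    and w: "\<And>j. j < k \<Longrightarrow> w j - (\<Sum>l<m. \<iota> (N $$ (l, j)) * v l) \<in> max_ideal P"
  shows "residue_coords bs (M * N) k w"
  unfolding residue_coords_def
proof (intro conjI allI impI)
  show "M * N \<in> carrier_mat (length bs) k" using M N by (auto simp: residue_coords_def)
  fix j assume j: "j < k"
  have Mc: "M \<in> carrier_mat (length bs) m" using M by (simp add: residue_coords_def)
  have "(\<Sum>i<length bs. \<iota> ((M * N) $$ (i, j)) * bs ! i)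
      = (\<Sum>i<length bs. \<Sum>l<m. \<iota> (N $$ (l, j)) * (\<iota> (M $$ (i, l)) * bs ! i))"
    using Mc N j
    by (intro sum.cong refl) (simp add: scalar_prod_def hom_distribs sum_distrib_right mult_ac
        lessThan_atLeast0)
  also have "\<dots> = (\<Sum>l<m. \<iota> (N $$ (l, j)) * (\<Sum>i<length bs. \<iota> (M $$ (i, l)) * bs ! i))"
    by (subst sum.swap) (simp add: sum_distrib_left)
  finally have eq: "w j - (\<Sum>i<length bs. \<iota> ((M * N) $$ (i, j)) * bs ! i)
      = (w j - (\<Sum>l<m. \<iota> (N $$ (l, j)) * v l))
        + (\<Sum>l<m. (v l - (\<Sum>i<length bs. \<iota> (M $$ (i, l)) * bs ! i)) * \<iota> (N $$ (l, j)))"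
    by (simp add: left_diff_distrib right_diff_distrib sum_subtractf mult.commute)
  show "w j - (\<Sum>i<length bs. \<iota> ((M * N) $$ (i, j)) * bs ! i) \<in> max_ideal P"
    unfolding eq using M w[OF j]
    by (intro max_ideal_add max_ideal_sum max_ideal_mult const_mem) (auto simp: residue_coords_def)
qed

lemma residue_basis_nth_mem: "residue_basis \<iota> P bs \<Longrightarrow> i < length bs \<Longrightarrow> bs ! i \<in> P"
  by (auto simp: residue_basis_def quotient_basis_def)

text \<open>If \<open>cs\<close> were longer, its coordinate matrix would have more columns than
  rows, and a kernel vector would be a relation between the classes of \<open>cs\<close>.\<close>

lemma residue_basis_length_le:
  assumes bs: "residue_basis \<iota> P bs" and cs: "residue_basis \<iota> P cs"
  shows "length cs \<le> length bs"
proof (rule ccontr)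
  assume "\<not> length cs \<le> length bs"
  obtain S where S: "residue_coords bs S (length cs) (\<lambda>j. cs ! j)"
    using residue_coords_exists[OF bs] residue_basis_nth_mem[OF cs] by metis
  have Sc: "S \<in> carrier_mat (length bs) (length cs)" using S by (simp add: residue_coords_def)
  obtain c where c0: "\<exists>j\<in>{..<length cs}. c j \<noteq> 0"
    and c: "\<forall>i\<in>{..<length bs}. (\<Sum>j<length cs. S $$ (i, j) * c j) = 0"
    using homogeneous_system_nontrivial[of "{..<length bs}" "{..<length cs}" "\<lambda>i j. S $$ (i, j)"]
      \<open>\<not> length cs \<le> length bs\<close> by auto
  define N where "N = mat (length cs) 1 (\<lambda>(i, j). c i)"
  have "residue_coords bs (S * N) 1 (\<lambda>_. \<Sum>l<length cs. \<iota> (c l) * cs ! l)"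
    by (rule residue_coords_compose[OF S]) (auto simp: N_def zero_max_ideal)
  moreover have "(S * N) $$ (i, 0) = 0" if "i < length bs" for i
    using c Sc that by (simp add: N_def scalar_prod_def lessThan_atLeast0)
  ultimately have "(\<Sum>l<length cs. \<iota> (c l) * cs ! l) \<in> max_ideal P"
    by (simp add: residue_coords_def)
  from residue_independentD[OF residue_independent_basis[OF cs] this] c0 show False by blast
qed

text \<open>The definite description ranges over all bases, so this is the independence of the norm
  from the basis: matrices in two bases are conjugate and have equal determinants.\<close>

lemma residue_norm_eqI:
  assumes bs: "residue_basis \<iota> P bs" and x: "x \<in> P"
    and A: "residue_coords bs A (length bs) (\<lambda>j. x * bs ! j)"
  shows "residue_norm \<iota> P x = det A"
  unfolding residue_norm_def
proof (rule the_equality)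
  show "\<exists>bs A'. residue_basis \<iota> P bs \<and> A' \<in> carrier_mat (length bs) (length bs) \<and>
     (\<forall>j<length bs. x * bs ! j - (\<Sum>i<length bs. \<iota> (A' $$ (i, j)) * bs ! i) \<in> max_ideal P) \<and>
     det A = det A'"
    using bs A by (auto simp: residue_coords_def)
next
  fix c assume "\<exists>cs A'. residue_basis \<iota> P cs \<and> A' \<in> carrier_mat (length cs) (length cs) \<and>
     (\<forall>j<length cs. x * cs ! j - (\<Sum>i<length cs. \<iota> (A' $$ (i, j)) * cs ! i) \<in> max_ideal P) \<and>
     c = det A'"
  then obtain cs A' where cs: "residue_basis \<iota> P cs" and cA: "c = det A'"
    and A': "residue_coords cs A' (length cs) (\<lambda>j. x * cs ! j)"
    unfolding residue_coords_def by blast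
  let ?n = "length bs"
  have n: "length cs = ?n" using residue_basis_length_le[OF bs cs] residue_basis_length_le[OF cs bs] by simp
  obtain S where S: "residue_coords bs S ?n (\<lambda>j. cs ! j)"
    using residue_coords_exists[OF bs] residue_basis_nth_mem[OF cs] n by metis
  obtain T where T: "residue_coords cs T ?n (\<lambda>j. bs ! j)"
    using residue_coords_exists[OF cs] residue_basis_nth_mem[OF bs] n by metis
  have car: "A \<in> carrier_mat ?n ?n" "A' \<in> carrier_mat ?n ?n" "S \<in> carrier_mat ?n ?n" "T \<in> carrier_mat ?n ?n"
    using A A' S T n by (auto simp: residue_coords_def)
  have "residue_coords bs (1\<^sub>m ?n) ?n (\<lambda>j. bs ! j)"
    by (auto simp: residue_coords_def zero_max_ideal if_distrib if_distribR sum.delta cong: if_cong)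
  moreover have "residue_coords bs (S * T) ?n (\<lambda>j. bs ! j)"
    by (rule residue_coords_compose[OF S car(4)]) (use T n in \<open>auto simp: residue_coords_def\<close>)
  ultimately have "S * T = 1\<^sub>m ?n" using residue_coords_unique[OF bs] by blast
  then have dST: "det S * det T = 1" using det_mult[OF car(3,4)] by simp
  \<comment> \<open>The elements \<open>x * cs ! j\<close> are expanded in \<open>bs\<close> in two
    ways: through the matrix of \<open>x\<close> in the basis \<open>cs\<close>, and through its
    matrix in \<open>bs\<close>.\<close>
  have "residue_coords bs (S * A') ?n (\<lambda>j. x * cs ! j)"
    by (rule residue_coords_compose[OF S car(2)]) (use A' n in \<open>auto simp: residue_coords_def\<close>)
  moreover have "residue_coords bs (A * S) ?n (\<lambda>j. x * cs ! j)"
  proof (rule residue_coords_compose[OF A car(3)])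
    fix j assume "j < ?n"
    then have "(cs ! j - (\<Sum>l<?n. \<iota> (S $$ (l, j)) * bs ! l)) * x \<in> max_ideal P"
      using S x by (intro max_ideal_mult) (auto simp: residue_coords_def)
    then show "x * cs ! j - (\<Sum>l<?n. \<iota> (S $$ (l, j)) * (x * bs ! l)) \<in> max_ideal P"
      by (simp add: right_diff_distrib sum_distrib_left mult_ac)
  qed
  ultimately have "S * A' = A * S" using residue_coords_unique[OF bs] by blast
  then have "det S * det A' = det A * det S" using det_mult[OF car(3,2)] det_mult[OF car(1,3)] by metis
  moreover have "det S \<noteq> 0" using dST by auto
  ultimately show "c = det A" using cA by auto
qed

text \<open>Multiplication by \<open>x * y\<close> is a composite, so its matrix is a
  product.\<close>

lemma residue_norm_mult:
  assumes x: "x \<in> P" and y: "y \<in> P"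
  shows "residue_norm \<iota> P (x * y) = residue_norm \<iota> P x * residue_norm \<iota> P y"
proof -
  obtain bs where bs: "residue_basis \<iota> P bs" using residue_basis_exists by blast
  let ?n = "length bs"
  obtain A where A: "residue_coords bs A ?n (\<lambda>j. x * bs ! j)"
    using residue_coords_exists[OF bs] residue_basis_nth_mem[OF bs] mult_mem[OF x] by metis
  obtain B where B: "residue_coords bs B ?n (\<lambda>j. y * bs ! j)"
    using residue_coords_exists[OF bs] residue_basis_nth_mem[OF bs] mult_mem[OF y] by metis
  have car: "A \<in> carrier_mat ?n ?n" "B \<in> carrier_mat ?n ?n" using A B by (auto simp: residue_coords_def)
  have "residue_coords bs (A * B) ?n (\<lambda>j. x * y * bs ! j)"
  proof (rule residue_coords_compose[OF A car(2)])
    fix j assume "j < ?n"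
    then have "(y * bs ! j - (\<Sum>l<?n. \<iota> (B $$ (l, j)) * bs ! l)) * x \<in> max_ideal P"
      using B x by (intro max_ideal_mult) (auto simp: residue_coords_def)
    then show "x * y * bs ! j - (\<Sum>l<?n. \<iota> (B $$ (l, j)) * (x * bs ! l)) \<in> max_ideal P"
      by (simp add: right_diff_distrib sum_distrib_left mult_ac)
  qed
  from residue_norm_eqI[OF bs mult_mem[OF x y] this] show ?thesis
    using residue_norm_eqI[OF bs x A] residue_norm_eqI[OF bs y B] det_mult[OF car] by simp
qed

lemma residue_norm_one: "residue_norm \<iota> P 1 = 1"
proof -
  obtain bs where bs: "residue_basis \<iota> P bs" using residue_basis_exists by blast
  have "residue_coords bs (1\<^sub>m (length bs)) (length bs) (\<lambda>j. 1 * bs ! j)"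
    by (auto simp: residue_coords_def zero_max_ideal if_distrib if_distribR sum.delta cong: if_cong)
  from residue_norm_eqI[OF bs one_mem this] show ?thesis by simp
qed

lemma residue_norm_inverse:
  assumes "x \<in> units_at P"
  shows "residue_norm \<iota> P (inverse x) = inverse (residue_norm \<iota> P x)" "residue_norm \<iota> P x \<noteq> 0"
proof -
  have "residue_norm \<iota> P x * residue_norm \<iota> P (inverse x) = 1"
    using assms residue_norm_mult[of x "inverse x"] residue_norm_one by (simp add: units_at_def)
  then show "residue_norm \<iota> P (inverse x) = inverse (residue_norm \<iota> P x)" "residue_norm \<iota> P x \<noteq> 0"
    using inverse_unique by fastforce+
qed

lemma residue_norm_divide:
  assumes "x \<in> units_at P" "y \<in> units_at P"
  shows "residue_norm \<iota> P (x / y) = residue_norm \<iota> P x / residue_norm \<iota> P y"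
  using assms residue_norm_mult[of x "inverse y"] residue_norm_inverse[of y]
  by (simp add: divide_inverse units_at_def)

lemma value_at_eqI:
  assumes "x - \<iota> c \<in> max_ideal P"
  shows "value_at \<iota> P x = c"
  unfolding value_at_def
proof (rule the_equality[of "\<lambda>c. x - \<iota> c \<in> max_ideal P", OF assms])
  fix d assume "x - \<iota> d \<in> max_ideal P"
  from max_ideal_diff[OF assms this] have "\<iota> (d - c) \<in> max_ideal P" by (simp add: hom_distribs)
  then show "d = c" using const_max_ideal_iff[of "d - c"] by simp
qed

lemma rational_basis:
  assumes "P \<in> rational_points \<iota>"
  shows "residue_basis \<iota> P [1]"
  unfolding residue_basis_def quotient_basis_def
proof (intro conjI ballI)
  show "set [1] \<subseteq> P" using one_mem by simp
  fix x assume "x \<in> P"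
  then obtain c where c: "x - \<iota> c \<in> max_ideal P" using assms by (auto simp: rational_points_def)
  show "\<exists>!cs. length cs = length [1 :: 'f] \<and>
      x - (\<Sum>i<length [1 :: 'f]. \<iota> (cs ! i) * [1] ! i) \<in> max_ideal P"
  proof (rule ex1I[of _ "[c]"])
    fix cs assume "length cs = length [1 :: 'f] \<and>
      x - (\<Sum>i<length [1 :: 'f]. \<iota> (cs ! i) * [1] ! i) \<in> max_ideal P"
    then show "cs = [c]" using value_at_eqI[OF c] value_at_eqI[of x "cs ! 0"]
      by (auto simp: length_Suc_conv)
  qed (use c in simp)
qed

lemma point_degree_rational:
  assumes "P \<in> rational_points \<iota>"
  shows "point_degree \<iota> P = 1"
  unfolding point_degree_def
proof (rule the_equality)
  show "\<exists>bs. residue_basis \<iota> P bs \<and> length bs = 1" using rational_basis[OF assms] by force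
  fix n assume "\<exists>bs. residue_basis \<iota> P bs \<and> length bs = n"
  then obtain bs where "residue_basis \<iota> P bs" "length bs = n" by blast
  then show "n = 1" using residue_basis_length_le[OF rational_basis[OF assms], of bs]
      residue_basis_length_le[of bs "[1]"] rational_basis[OF assms] by simp
qed

text \<open>The basis is \<open>[1]\<close> and the matrix has size 1. This connects norms with the
  section values in \<open>\<mu>\<close> and \<open>lam_s\<close>.\<close>

lemma residue_norm_rational:
  assumes P: "P \<in> rational_points \<iota>" and x: "x \<in> P"
  shows "residue_norm \<iota> P x = value_at \<iota> P x"
proof -
  obtain c where c: "x - \<iota> c \<in> max_ideal P" using P x by (auto simp: rational_points_def)
  have "residue_coords [1] (mat 1 1 (\<lambda>_. c)) (length [1 :: 'f]) (\<lambda>j. x * [1] ! j)"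
    using c by (simp add: residue_coords_def)
  from residue_norm_eqI[OF rational_basis[OF P] x this] show ?thesis
    using value_at_eqI[OF c] det_single[of "mat 1 1 (\<lambda>_. c)"] by simp
qed

end

section \<open>Divisors and line bundles\<close>

lemma (in function_field) curve_pointI: "P \<in> closed_points \<iota> \<Longrightarrow> curve_point \<iota> P"
  by unfold_locales

lemma is_divisor_diff: "is_divisor \<iota> D \<Longrightarrow> is_divisor \<iota> E \<Longrightarrow> is_divisor \<iota> (D - E)"
  unfolding is_divisor_def using Poly_Mapping.keys_diff[of D E] by blast

lemma is_divisor_lookup: "is_divisor \<iota> D \<Longrightarrow> P \<notin> closed_points \<iota> \<Longrightarrow> Poly_Mapping.lookup D P = 0"
  by (auto simp: is_divisor_def in_keys_iff)

lemma disjoint_div_commute: "disjoint_div D E \<longleftrightarrow> disjoint_div E D"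
  by (auto simp: disjoint_div_def)

text \<open>Only inclusions of supports are asked for, because points may cancel in a difference of
  divisors.\<close>

lemma disjoint_div_Un:
  assumes "Poly_Mapping.keys F \<subseteq> Poly_Mapping.keys F1 \<union> Poly_Mapping.keys F2"
    and "Poly_Mapping.keys G \<subseteq> Poly_Mapping.keys G1 \<union> Poly_Mapping.keys G2"
    and "disjoint_div F1 G1" "disjoint_div F1 G2" "disjoint_div F2 G1" "disjoint_div F2 G2"
  shows "disjoint_div F G"
  using assms unfolding disjoint_div_def by fast

text \<open>Because of cancellation, two divisors and their difference are best compared over a
  common finite set of points. The same device is used for values at divisors, where an added factor
  has exponent 0 and equals 1 even if the norm vanishes.\<close>

lemma div_degree_superset:
  "finite S \<Longrightarrow> Poly_Mapping.keys D \<subseteq> S \<Longrightarrow>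
    div_degree \<iota> D = (\<Sum>P\<in>S. Poly_Mapping.lookup D P * int (point_degree \<iota> P))"
  unfolding div_degree_def by (rule sum.mono_neutral_left) (auto simp: in_keys_iff)

lemma div_degree_diff: "div_degree \<iota> (D - E) = div_degree \<iota> D - div_degree \<iota> E"
proof -
  let ?S = "Poly_Mapping.keys D \<union> Poly_Mapping.keys E"
  have "Poly_Mapping.keys (D - E) \<subseteq> ?S" by (rule Poly_Mapping.keys_diff)
  then show ?thesis
    by (simp add: div_degree_superset[of ?S] lookup_minus left_diff_distrib sum_subtractf)
qed

lemma fun_at_div_superset:
  "finite S \<Longrightarrow> Poly_Mapping.keys F \<subseteq> S \<Longrightarrow>
    fun_at_div \<iota> f F = (\<Prod>P\<in>S. residue_norm \<iota> P f powi Poly_Mapping.lookup F P)"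
  unfolding fun_at_div_def by (rule prod.mono_neutral_left) (auto simp: in_keys_iff)

text \<open>Exponents subtract only for nonzero norms. The supports may overlap, so the case of
  equal points is included.\<close>

lemma fun_at_div_diff:
  assumes "\<And>P. P \<in> Poly_Mapping.keys F \<union> Poly_Mapping.keys G \<Longrightarrow> residue_norm \<iota> P f \<noteq> 0"
  shows "fun_at_div \<iota> f (F - G) = fun_at_div \<iota> f F / fun_at_div \<iota> f G"
proof -
  let ?S = "Poly_Mapping.keys F \<union> Poly_Mapping.keys G"
  have "Poly_Mapping.keys (F - G) \<subseteq> ?S" by (rule Poly_Mapping.keys_diff)
  then show ?thesis using assms
    by (simp add: fun_at_div_superset[of ?S] lookup_minus power_int_diff prod_dividef)
qed

context function_field
begin

lemma fun_at_div_nonzero: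
  assumes F: "is_divisor \<iota> F" and f: "\<And>P. P \<in> Poly_Mapping.keys F \<Longrightarrow> f \<in> units_at P"
  shows "fun_at_div \<iota> f F \<noteq> 0"
proof -
  have "residue_norm \<iota> P f \<noteq> 0" if "P \<in> Poly_Mapping.keys F" for P
  proof -
    interpret curve_point \<iota> P using F that by (intro curve_pointI) (auto simp: is_divisor_def)
    show ?thesis using f[OF that] by (rule residue_norm_inverse)
  qed
  then show ?thesis by (simp add: fun_at_div_def)
qed

lemma fun_at_div_inverse:
  assumes F: "is_divisor \<iota> F" and f: "\<And>P. P \<in> Poly_Mapping.keys F \<Longrightarrow> f \<in> units_at P"
  shows "fun_at_div \<iota> (inverse f) F = inverse (fun_at_div \<iota> f F)"
proof -
  have "residue_norm \<iota> P (inverse f) = inverse (residue_norm \<iota> P f)" if "P \<in> Poly_Mapping.keys F" for P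
  proof -
    interpret curve_point \<iota> P using F that by (intro curve_pointI) (auto simp: is_divisor_def)
    show ?thesis using f[OF that] by (rule residue_norm_inverse)
  qed
  then show ?thesis by (simp add: fun_at_div_def power_int_inverse prod_inversef[unfolded o_def, symmetric])
qed

lemma fun_at_div_diff_units:
  assumes FG: "is_divisor \<iota> F" "is_divisor \<iota> G"
    and f: "\<And>P. P \<in> Poly_Mapping.keys F \<union> Poly_Mapping.keys G \<Longrightarrow> f \<in> units_at P"
  shows "fun_at_div \<iota> f (F - G) = fun_at_div \<iota> f F / fun_at_div \<iota> f G"
proof (rule fun_at_div_diff)
  fix P assume P: "P \<in> Poly_Mapping.keys F \<union> Poly_Mapping.keys G"
  interpret curve_point \<iota> P using P FG by (intro curve_pointI) (auto simp: is_divisor_def)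
  show "residue_norm \<iota> P f \<noteq> 0" using f[OF P] by (rule residue_norm_inverse)
qed

end

section \<open>Sections of powers of a line bundle, and principal divisors\<close>

locale curve_line_bundle = function_field \<iota> for \<iota> :: "'k::field \<Rightarrow> 'f::field" +
  fixes L :: "('f, 'm::ab_group_add) line_bundle"
  assumes line_bundle: "is_line_bundle \<iota> L"
begin

lemma fscale_one: "fscale L 1 m = m"
  and fscale_fscale: "fscale L a (fscale L b m) = fscale L (a * b) m"
  and fscale_eq_0_iff: "fscale L a m = 0 \<longleftrightarrow> a = 0 \<or> m = 0"
  and fscale_cancel: "m \<noteq> 0 \<Longrightarrow> fscale L a m = fscale L b m \<longleftrightarrow> a = b"
proof -
  interpret V: vector_space "fscale L" using line_bundle by (simp add: is_line_bundle_def)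
  show "fscale L 1 m = m" "fscale L a (fscale L b m) = fscale L (a * b) m"
    "fscale L a m = 0 \<longleftrightarrow> a = 0 \<or> m = 0" "m \<noteq> 0 \<Longrightarrow> fscale L a m = fscale L b m \<longleftrightarrow> a = b"
    by simp_all
qed

lemma obtain_section:
  obtains m :: 'm where "m \<noteq> 0"
  using line_bundle by (auto simp: is_line_bundle_def)

lemma obtain_ratio:
  assumes "m \<noteq> 0" "m' \<noteq> 0"
  obtains a where "a \<noteq> 0" "m' = fscale L a m"
proof -
  obtain m0 where m0: "m0 \<noteq> 0" "range (\<lambda>a. fscale L a m0) = UNIV"
    using line_bundle by (auto simp: is_line_bundle_def)
  obtain b where b: "m = fscale L b m0" using m0(2) by (metis rangeE UNIV_I)
  obtain c where c: "m' = fscale L c m0" using m0(2) by (metis rangeE UNIV_I)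
  have "b \<noteq> 0" "c \<noteq> 0" using b c assms by (auto simp: fscale_eq_0_iff)
  then have "m' = fscale L (c / b) m" "c / b \<noteq> 0" using b c by (simp_all add: fscale_fscale)
  then show ?thesis using that by blast
qed

lemma local_generator_exists: "P \<in> closed_points \<iota> \<Longrightarrow> \<exists>u. local_generator L P u"
  using line_bundle by (simp add: is_line_bundle_def)

lemma local_generator_scale_unit:
  assumes P: "P \<in> closed_points \<iota>" and u: "local_generator L P u" and au: "local_generator L P (fscale L a u)"
  shows "a \<in> units_at P"
proof -
  interpret curve_point \<iota> P using P by (rule curve_pointI)
  have nz: "u \<noteq> 0" "a \<noteq> 0" using u au by (auto simp: local_generator_def fscale_eq_0_iff)
  have st: "(\<lambda>b. fscale L b u) ` P = (\<lambda>b. fscale L b (fscale L a u)) ` P"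
    using u au by (simp add: local_generator_def)
  have "fscale L a u \<in> (\<lambda>b. fscale L b (fscale L a u)) ` P"
    using one_mem by (rule rev_image_eqI) (simp add: fscale_one)
  then have "a \<in> P" using nz unfolding st[symmetric] by (auto simp: fscale_cancel)
  have "u \<in> (\<lambda>b. fscale L b u) ` P" using one_mem by (rule rev_image_eqI) (simp add: fscale_one)
  then obtain b where b: "b \<in> P" "u = fscale L (b * a) u" unfolding st by (auto simp: fscale_fscale)
  then have "b * a = 1" using nz(1) fscale_cancel[of u "b * a" 1] by (simp add: fscale_one)
  then have "inverse a = b" by (simp add: inverse_unique mult.commute)
  with b \<open>a \<in> P\<close> nz show ?thesis by (simp add: units_at_def)
qed

text \<open>Both \<open>m\<close> and \<open>f m\<close> generate the stalk of \<open>L\<close> at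
  almost all points, and wherever they both do, \<open>f\<close> is a unit.\<close>

lemma finite_principal_support:
  assumes "f \<noteq> 0"
  shows "finite {P \<in> closed_points \<iota>. ord_at P f \<noteq> 0}"
proof -
  obtain m :: 'm where m: "m \<noteq> 0" by (rule obtain_section)
  have fin: "finite {P \<in> closed_points \<iota>. \<not> local_generator L P m'}" if "m' \<noteq> 0" for m'
    using line_bundle that by (simp add: is_line_bundle_def)
  have "ord_at P f = 0" if P: "P \<in> closed_points \<iota>" "local_generator L P m" "local_generator L P (fscale L f m)" for P
    using local_generator_scale_unit[OF P] curve_point.ord_unit_iff[OF curve_pointI[OF P(1)]] by simp
  then have "{P \<in> closed_points \<iota>. ord_at P f \<noteq> 0} \<subseteq>
      {P \<in> closed_points \<iota>. \<not> local_generator L P m} \<union>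
      {P \<in> closed_points \<iota>. \<not> local_generator L P (fscale L f m)}" by blast
  then show ?thesis using fin[OF m] fin[of "fscale L f m"] m assms
    by (meson fscale_eq_0_iff finite_UnI finite_subset)
qed

lemma lookup_principal_div:
  assumes "f \<noteq> 0"
  shows "Poly_Mapping.lookup (principal_div \<iota> f) P = (if P \<in> closed_points \<iota> then ord_at P f else 0)"
proof -
  have "finite {P. (if P \<in> closed_points \<iota> then ord_at P f else 0) \<noteq> 0}"
    by (rule finite_subset[OF _ finite_principal_support[OF assms]]) (auto split: if_splits)
  then show ?thesis by (simp add: principal_div_def Abs_poly_mapping_inverse)
qed

text \<open>Coordinates with respect to different \<open>u\<close> differ by nonzero factors, so one
  vanishing coordinate makes the section zero.\<close>

lemma power_section_nonzero:
  assumes s: "s \<in> power_sections L n" "s \<noteq> 0" and u: "u \<noteq> 0"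
  shows "s u \<noteq> 0"
proof -
  obtain u0 where u0: "s u0 \<noteq> 0" using s(2) by (auto simp: fun_eq_iff)
  have "u0 \<noteq> 0" using u0 s(1) by (auto simp: power_sections_def)
  then obtain a where "a \<noteq> 0" "u0 = fscale L a u" using obtain_ratio[OF u] by metis
  then show ?thesis using s(1) u u0 by (auto simp: power_sections_def)
qed

text \<open>Two generators differ by a unit \<open>a\<close>, and the coordinate changes by the unit
  \<open>a powi (- n)\<close>.\<close>

lemma ord_section_eq:
  assumes P: "P \<in> closed_points \<iota>" and s: "s \<in> power_sections L n" "s \<noteq> 0" and u: "local_generator L P u"
  shows "ord_section L P s = ord_at P (s u)"
  unfolding ord_section_def
proof (rule the_equality)
  interpret curve_point \<iota> P using P by (rule curve_pointI)
  show "\<exists>u'. local_generator L P u' \<and> ord_at P (s u) = ord_at P (s u')" using u by blast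
  fix k assume "\<exists>u'. local_generator L P u' \<and> k = ord_at P (s u')"
  then obtain u' where u': "local_generator L P u'" and k: "k = ord_at P (s u')" by blast
  have nz: "u \<noteq> 0" "u' \<noteq> 0" using u u' by (auto simp: local_generator_def)
  then obtain a where a: "a \<noteq> 0" "u' = fscale L a u" by (rule obtain_ratio)
  then have "a \<in> units_at P" using local_generator_scale_unit[OF P u] u' by simp
  then have au: "a powi (- n) \<in> units_at P" by (rule units_powi)
  have "s u' = a powi (- n) * s u" using s(1) a nz by (simp add: power_sections_def)
  then show "k = ord_at P (s u)"
    using ord_mult[of "a powi (- n)" "s u"] au power_section_nonzero[OF s nz(1)]
    by (simp add: k ord_unit_iff)
qed

text \<open>\<open>Abs_poly_mapping\<close> needs finite support: for a fixed \<open>m\<close>, at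
  almost all points \<open>m\<close> generates the stalk and \<open>s m\<close> has order 0.\<close>

lemma lookup_section_div:
  assumes s: "s \<in> power_sections L n" "s \<noteq> 0"
  shows "Poly_Mapping.lookup (section_div \<iota> L s) P = (if P \<in> closed_points \<iota> then ord_section L P s else 0)"
proof -
  obtain m :: 'm where m: "m \<noteq> 0" by (rule obtain_section)
  have "finite {P \<in> closed_points \<iota>. \<not> local_generator L P m}"
    using line_bundle m by (simp add: is_line_bundle_def)
  moreover have "finite {P \<in> closed_points \<iota>. ord_at P (s m) \<noteq> 0}"
    by (rule finite_principal_support[OF power_section_nonzero[OF s m]])
  moreover have "{P. (if P \<in> closed_points \<iota> then ord_section L P s else 0) \<noteq> 0} \<subseteq>
      {P \<in> closed_points \<iota>. \<not> local_generator L P m} \<union> {P \<in> closed_points \<iota>. ord_at P (s m) \<noteq> 0}"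
    using ord_section_eq[OF _ s] by (auto split: if_splits)
  ultimately have "finite {P. (if P \<in> closed_points \<iota> then ord_section L P s else 0) \<noteq> 0}"
    by (meson finite_UnI finite_subset)
  then show ?thesis by (simp add: section_div_def Abs_poly_mapping_inverse)
qed

lemma lookup_section_div_generator:
  assumes "s \<in> power_sections L n" "s \<noteq> 0" "P \<in> closed_points \<iota>" "local_generator L P u"
  shows "Poly_Mapping.lookup (section_div \<iota> L s) P = ord_at P (s u)"
  using assms by (simp add: lookup_section_div ord_section_eq)

lemma is_divisor_section_div:
  "s \<in> power_sections L n \<Longrightarrow> s \<noteq> 0 \<Longrightarrow> is_divisor \<iota> (section_div \<iota> L s)"
  by (auto simp: is_divisor_def in_keys_iff lookup_section_div split: if_splits)

lemma power_sections_mult: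
  "a \<in> power_sections L n \<Longrightarrow> b \<in> power_sections L m \<Longrightarrow> (\<lambda>u. a u * b u) \<in> power_sections L (n + m)"
  by (auto simp: power_sections_def power_int_add power_int_diff power_int_minus_divide)

lemma power_sections_mult_nonzero:
  assumes a: "a \<in> power_sections L n" "a \<noteq> 0" and b: "b \<in> power_sections L m" "b \<noteq> 0"
  shows "(\<lambda>u. a u * b u) \<noteq> 0"
proof -
  obtain u :: 'm where "u \<noteq> 0" by (rule obtain_section)
  then have "a u * b u \<noteq> 0" using power_section_nonzero a b by simp
  then show ?thesis by (auto simp: fun_eq_iff)
qed

lemma section_div_mult:
  assumes a: "a \<in> power_sections L n" "a \<noteq> 0" and b: "b \<in> power_sections L m" "b \<noteq> 0"
  shows "section_div \<iota> L (\<lambda>u. a u * b u) = section_div \<iota> L a + section_div \<iota> L b"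
proof (rule poly_mapping_eqI)
  fix P
  note ab = power_sections_mult[OF a(1) b(1)] power_sections_mult_nonzero[OF a b]
  show "Poly_Mapping.lookup (section_div \<iota> L (\<lambda>u. a u * b u)) P =
      Poly_Mapping.lookup (section_div \<iota> L a + section_div \<iota> L b) P"
  proof (cases "P \<in> closed_points \<iota>")
    case True
    then obtain u where u: "local_generator L P u" using local_generator_exists by blast
    then have nz: "u \<noteq> 0" by (simp add: local_generator_def)
    show ?thesis
      using curve_point.ord_mult[OF curve_pointI[OF True], of "a u" "b u"]
        power_section_nonzero[OF a nz] power_section_nonzero[OF b nz]
      by (simp add: lookup_add lookup_section_div_generator[OF ab True u]
          lookup_section_div_generator[OF a True u] lookup_section_div_generator[OF b True u])
  qed (simp add: lookup_add lookup_section_div[OF ab] lookup_section_div[OF a] lookup_section_div[OF b])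
qed

lemma section_ratio_eq:
  assumes a: "a \<in> power_sections L n" and b: "b \<in> power_sections L n" "b \<noteq> 0" and u: "u \<noteq> 0"
  shows "section_ratio a b = a u / b u"
  unfolding section_ratio_def
proof (rule the_equality)
  show "\<forall>u'. u' \<noteq> 0 \<longrightarrow> a u' = a u / b u * b u'"
  proof (intro allI impI)
    fix u' :: 'm assume "u' \<noteq> 0"
    with u obtain c where c: "c \<noteq> 0" "u' = fscale L c u" by (rule obtain_ratio)
    then have "a u' = c powi (- n) * a u" "b u' = c powi (- n) * b u"
      using a b(1) u by (auto simp: power_sections_def)
    then show "a u' = a u / b u * b u'" using power_section_nonzero[OF b u] by simp
  qed
  fix c assume "\<forall>u. u \<noteq> 0 \<longrightarrow> a u = c * b u"
  then show "c = a u / b u" using u power_section_nonzero[OF b u] by simp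
qed

lemma section_ratio_nonzero:
  assumes a: "a \<in> power_sections L n" "a \<noteq> 0" and b: "b \<in> power_sections L n" "b \<noteq> 0"
  shows "section_ratio a b \<noteq> 0"
proof -
  obtain u :: 'm where u: "u \<noteq> 0" by (rule obtain_section)
  then show ?thesis
    using section_ratio_eq[OF a(1) b u] power_section_nonzero[OF a u] power_section_nonzero[OF b u] by simp
qed

lemma section_ratio_swap:
  assumes a: "a \<in> power_sections L n" "a \<noteq> 0" and b: "b \<in> power_sections L n" "b \<noteq> 0"
  shows "section_ratio b a = inverse (section_ratio a b)"
proof -
  obtain u :: 'm where u: "u \<noteq> 0" by (rule obtain_section)
  then show ?thesis using section_ratio_eq[OF a(1) b u] section_ratio_eq[OF b(1) a u] by simp
qed

lemma principal_div_section_ratio: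
  assumes a: "a \<in> power_sections L n" "a \<noteq> 0" and b: "b \<in> power_sections L n" "b \<noteq> 0"
  shows "principal_div \<iota> (section_ratio a b) = section_div \<iota> L a - section_div \<iota> L b"
proof (rule poly_mapping_eqI)
  fix P
  note nz = section_ratio_nonzero[OF a b]
  show "Poly_Mapping.lookup (principal_div \<iota> (section_ratio a b)) P =
      Poly_Mapping.lookup (section_div \<iota> L a - section_div \<iota> L b) P"
  proof (cases "P \<in> closed_points \<iota>")
    case True
    then obtain u where u: "local_generator L P u" using local_generator_exists by blast
    then have u0: "u \<noteq> 0" by (simp add: local_generator_def)
    show ?thesis
      using curve_point.ord_divide[OF curve_pointI[OF True], of "a u" "b u"]
        power_section_nonzero[OF a u0] power_section_nonzero[OF b u0] True
        lookup_principal_div[OF nz, of P]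
      by (simp add: lookup_minus section_ratio_eq[OF a(1) b u0]
          lookup_section_div_generator[OF a True u] lookup_section_div_generator[OF b True u])
  qed (simp add: lookup_minus lookup_principal_div[OF nz] lookup_section_div[OF a] lookup_section_div[OF b])
qed

lemma section_ratio_unit:
  assumes a: "a \<in> power_sections L n" "a \<noteq> 0" and b: "b \<in> power_sections L n" "b \<noteq> 0"
    and P: "P \<in> closed_points \<iota>" "P \<notin> Poly_Mapping.keys (section_div \<iota> L a)"
      "P \<notin> Poly_Mapping.keys (section_div \<iota> L b)"
  shows "section_ratio a b \<in> units_at P"
proof -
  have "Poly_Mapping.lookup (principal_div \<iota> (section_ratio a b)) P = 0"
    using P(2,3) by (simp add: principal_div_section_ratio[OF a b] lookup_minus in_keys_iff)
  then show ?thesis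
    using P(1) section_ratio_nonzero[OF a b] curve_point.ord_unit_iff[OF curve_pointI[OF P(1)]]
    by (simp add: lookup_principal_div)
qed

text \<open>\<open>has_degree\<close> speaks of sections of the form \<open>coordinate L m\<close>;
  every section of the first power arises so, from \<open>m = s(u0) u0\<close>.\<close>

lemma degree_section_div:
  assumes deg: "has_degree \<iota> L \<delta>" and s: "s \<in> power_sections L 1" "s \<noteq> 0"
  shows "div_degree \<iota> (section_div \<iota> L s) = \<delta>"
proof -
  obtain u0 :: 'm where u0: "u0 \<noteq> 0" by (rule obtain_section)
  let ?m = "fscale L (s u0) u0"
  have "coordinate L ?m u = s u" for u
  proof (cases "u = 0")
    case True
    then show ?thesis using s(1) by (simp add: coordinate_def power_sections_def)
  next
    case False
    with u0 obtain a where a: "a \<noteq> 0" "u = fscale L a u0" by (rule obtain_ratio)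
    then have "s u = s u0 / a" using s(1) u0 by (simp add: power_sections_def field_simps)
    then have "?m = fscale L (s u) u" using a by (simp add: fscale_fscale)
    then show ?thesis using False by (simp add: coordinate_def fscale_cancel)
  qed
  then have "coordinate L ?m = s" by blast
  moreover have "?m \<noteq> 0" using power_section_nonzero[OF s u0] u0 by (simp add: fscale_eq_0_iff)
  ultimately show ?thesis using deg unfolding has_degree_def by metis
qed

end

section \<open>The line bundles of divisors\<close>

lemma fscale_O_div [simp]: "fscale (O_div E) = (*)"
  by (simp add: O_div_def)

lemma coordinate_O_div: "coordinate (O_div E) s u = s / u"
proof (cases "u = 0")
  case False
  then have "(THE c. s = c * u) = s / u" by (intro the_equality) (auto simp: field_simps)
  with False show ?thesis by (simp add: coordinate_def)
qed (simp add: coordinate_def)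

lemma (in curve_point) ord_surj: "\<exists>h. h \<noteq> 0 \<and> ord_at P h = n"
proof -
  obtain \<pi> where \<pi>: "uniformizer P \<pi>" by (rule obtain_uniformizer)
  then show ?thesis
    using ord_at_eqI[OF \<pi> units_one, of "\<pi> powi n" n] by (auto simp: uniformizer_def intro!: exI[of _ "\<pi> powi n"])
qed

text \<open>A generator has the least order occurring in the stalk, and the bound
  \<open>- E(P)\<close> is attained because \<open>ord_at P\<close> is surjective.\<close>

lemma (in curve_point) local_generator_O_div:
  "local_generator (O_div E) P u \<longleftrightarrow> u \<noteq> 0 \<and> ord_at P u = - Poly_Mapping.lookup E P"
proof
  assume u: "local_generator (O_div E) P u"
  then have nz: "u \<noteq> 0"
    and st: "{h. h = 0 \<or> - Poly_Mapping.lookup E P \<le> ord_at P h} = (\<lambda>a. a * u) ` P"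
    by (auto simp: local_generator_def O_div_def)
  have "u \<in> (\<lambda>a. a * u) ` P" using one_mem by force
  then have le: "- Poly_Mapping.lookup E P \<le> ord_at P u" using nz st by blast
  obtain h where h: "h \<noteq> 0" "ord_at P h = - Poly_Mapping.lookup E P" using ord_surj by blast
  then have "h \<in> (\<lambda>a. a * u) ` P" unfolding st[symmetric] by simp
  then obtain a where a: "a \<in> P" "h = a * u" by blast
  then have "a \<noteq> 0" using h by auto
  then have "ord_at P u \<le> - Poly_Mapping.lookup E P"
    using a h nz ord_mult[of a u] ord_nonneg_iff[of a] by simp
  with le nz show "u \<noteq> 0 \<and> ord_at P u = - Poly_Mapping.lookup E P" by simp
next
  assume u: "u \<noteq> 0 \<and> ord_at P u = - Poly_Mapping.lookup E P"
  have "(h = 0 \<or> ord_at P u \<le> ord_at P h) \<longleftrightarrow> h \<in> (\<lambda>a. a * u) ` P" for h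
  proof (cases "h = 0")
    case True
    then show ?thesis using zero_mem by force
  next
    case False
    have "h \<in> (\<lambda>a. a * u) ` P \<longleftrightarrow> h / u \<in> P" using u by (auto intro!: image_eqI[of _ _ "h / u"])
    then show ?thesis using False u ord_nonneg_iff[of "h / u"] ord_divide[of h u] by auto
  qed
  then show "local_generator (O_div E) P u" using u by (auto simp: local_generator_def O_div_def)
qed

lemma (in curve_point) generators_O_div_ratio:
  "local_generator (O_div E) P u \<Longrightarrow> local_generator (O_div E) P s \<Longrightarrow> s / u \<in> units_at P"
  by (auto simp: local_generator_O_div ord_unit_iff ord_divide)

text \<open>Computed directly from the definitions: dividing by a generator, of order
  \<open>- E(P)\<close>, adds \<open>E(P)\<close> to the order of \<open>s\<close>.\<close>

lemma (in curve_line_bundle) section_div_O_div: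
  assumes E: "is_divisor \<iota> E" and s: "s \<noteq> 0"
  shows "section_div \<iota> (O_div E) (coordinate (O_div E) s) = principal_div \<iota> s + E"
proof -
  have "ord_section (O_div E) P (coordinate (O_div E) s) = ord_at P s + Poly_Mapping.lookup E P"
    if P: "P \<in> closed_points \<iota>" for P
    unfolding ord_section_def
  proof (rule the_equality)
    interpret curve_point \<iota> P using P by (rule curve_pointI)
    show "\<exists>u. local_generator (O_div E) P u \<and>
        ord_at P s + Poly_Mapping.lookup E P = ord_at P (coordinate (O_div E) s u)"
      using ord_surj[of "- Poly_Mapping.lookup E P"] s
      by (auto simp: local_generator_O_div coordinate_O_div ord_divide)
    show "k = ord_at P s + Poly_Mapping.lookup E P"
      if "\<exists>u. local_generator (O_div E) P u \<and> k = ord_at P (coordinate (O_div E) s u)" for k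
      using that s by (auto simp: local_generator_O_div coordinate_O_div ord_divide)
  qed
  then have "(\<lambda>P. if P \<in> closed_points \<iota> then ord_section (O_div E) P (coordinate (O_div E) s) else 0)
      = Poly_Mapping.lookup (principal_div \<iota> s + E)"
    using is_divisor_lookup[OF E] by (auto simp: lookup_add lookup_principal_div[OF s])
  then show ?thesis by (simp add: section_div_def)
qed

context curve_line_bundle
begin

lemma section_norm_mult:
  assumes F: "is_divisor \<iota> F" and G: "\<And>P. P \<in> Poly_Mapping.keys F \<Longrightarrow> G \<in> units_at P"
    and s: "\<And>P. P \<in> Poly_Mapping.keys F \<Longrightarrow> local_generator (O_div E) P s"
  shows "section_norm \<iota> F (O_div E) (G * s) u = fun_at_div \<iota> G F * section_norm \<iota> F (O_div E) s u"
proof (cases "frame_along F (O_div E) u")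
  case True
  have "residue_norm \<iota> P (G * s / u P) = residue_norm \<iota> P G * residue_norm \<iota> P (s / u P)"
    if P: "P \<in> Poly_Mapping.keys F" for P
  proof -
    interpret curve_point \<iota> P using F P by (intro curve_pointI) (auto simp: is_divisor_def)
    have "s / u P \<in> units_at P" using True s[OF P] P by (auto simp: frame_along_def intro: generators_O_div_ratio)
    with G[OF P] residue_norm_mult[of G "s / u P"] show ?thesis by (simp add: units_at_def)
  qed
  with True show ?thesis
    by (simp add: section_norm_def coordinate_O_div fun_at_div_def power_int_mult_distrib prod.distrib)
qed (simp add: section_norm_def)

text \<open>Scaling the frame by \<open>a\<close> divides the coordinates of \<open>s\<close> by
  \<open>a\<close>, whence the negative exponent in \<open>norm_space\<close>.\<close>

lemma section_norm_mem_norm_space: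
  assumes F: "is_divisor \<iota> F" and s: "\<And>P. P \<in> Poly_Mapping.keys F \<Longrightarrow> local_generator (O_div E) P s"
  shows "section_norm \<iota> F (O_div E) s \<in> norm_space \<iota> F (O_div E)"
  unfolding norm_space_def
proof (intro CollectI conjI allI impI)
  fix u a assume u: "frame_along F (O_div E) u" and a: "\<forall>P\<in>Poly_Mapping.keys F. a P \<in> units_at P"
  have *: "local_generator (O_div E) P (a P * u P) \<and>
      residue_norm \<iota> P (s / (a P * u P)) = inverse (residue_norm \<iota> P (a P)) * residue_norm \<iota> P (s / u P)"
    if P: "P \<in> Poly_Mapping.keys F" for P
  proof -
    interpret curve_point \<iota> P using F P by (intro curve_pointI) (auto simp: is_divisor_def)
    have up: "local_generator (O_div E) P (u P)" using u P by (simp add: frame_along_def)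
    have aP: "a P \<in> units_at P" using a P by blast
    have "s / u P \<in> units_at P" using generators_O_div_ratio[OF up s[OF P]] .
    then have "residue_norm \<iota> P (s / u P / a P) = residue_norm \<iota> P (s / u P) / residue_norm \<iota> P (a P)"
      using aP by (rule residue_norm_divide)
    moreover have "local_generator (O_div E) P (a P * u P)"
      using up aP by (auto simp: local_generator_O_div ord_unit_iff ord_mult)
    ultimately show ?thesis by (simp add: field_simps)
  qed
  then have "frame_along F (O_div E) (\<lambda>P. a P * u P)" by (simp add: frame_along_def)
  with u * show "section_norm \<iota> F (O_div E) s (\<lambda>P. fscale (O_div E) (a P) (u P)) =
      (\<Prod>P\<in>Poly_Mapping.keys F. residue_norm \<iota> P (a P) powi - Poly_Mapping.lookup F P) *
      section_norm \<iota> F (O_div E) s u"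
    by (simp add: section_norm_def coordinate_O_div power_int_mult_distrib power_int_minus
        power_int_inverse prod.distrib)
qed (simp add: section_norm_def)

text \<open>In the frame given by \<open>s\<close> itself, the coordinate of its norm is 1.\<close>

lemma section_norm_nonzero:
  assumes F: "is_divisor \<iota> F" and s: "\<And>P. P \<in> Poly_Mapping.keys F \<Longrightarrow> local_generator (O_div E) P s"
  shows "section_norm \<iota> F (O_div E) s \<noteq> (\<lambda>_. 0)"
proof -
  have "residue_norm \<iota> P (s / s) = 1" if P: "P \<in> Poly_Mapping.keys F" for P
    using curve_point.residue_norm_one[OF curve_pointI, of P] F P s[OF P]
    by (auto simp: is_divisor_def local_generator_def)
  then have "section_norm \<iota> F (O_div E) s (\<lambda>_. s) = 1"
    using s by (simp add: section_norm_def frame_along_def coordinate_O_div)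
  then show ?thesis by (metis zero_neq_one)
qed

text \<open>Division by \<open>f\<close> carries generators of \<open>O(E)\<close> to generators of
  \<open>O(E + (f))\<close>, so frames correspond and the coordinates \<open>s / (u / f)\<close> and
  \<open>f s / u\<close> agree.\<close>

lemma norm_map_section_norm:
  assumes F: "is_divisor \<iota> F" and f: "f \<noteq> 0"
  shows "norm_map (\<lambda>h. f * h) (section_norm \<iota> F (O_div (E + principal_div \<iota> f)) s) =
    section_norm \<iota> F (O_div E) (f * s)"
proof
  fix u
  have inv: "inv_into UNIV (\<lambda>h. f * h) x = x / f" for x
    using f by (intro inv_into_f_eq) (auto simp: inj_on_def)
  have "local_generator (O_div (E + principal_div \<iota> f)) P (u P / f) \<longleftrightarrow> local_generator (O_div E) P (u P)"
    if P: "P \<in> Poly_Mapping.keys F" for P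
  proof -
    have Pc: "P \<in> closed_points \<iota>" using F P by (auto simp: is_divisor_def)
    then interpret curve_point \<iota> P by (rule curve_pointI)
    show ?thesis using f Pc
      by (auto simp: local_generator_O_div lookup_add lookup_principal_div ord_divide)
  qed
  then have "frame_along F (O_div (E + principal_div \<iota> f)) (\<lambda>P. u P / f) \<longleftrightarrow> frame_along F (O_div E) u"
    by (simp add: frame_along_def)
  then show "norm_map (\<lambda>h. f * h) (section_norm \<iota> F (O_div (E + principal_div \<iota> f)) s) u =
      section_norm \<iota> F (O_div E) (f * s) u"
    unfolding norm_map_def inv section_norm_def coordinate_O_div by (simp add: mult.commute)
qed

end

section \<open>The action on the Poincare torsor\<close>

lemma norm_space_scale: "\<phi> \<in> norm_space \<iota> F M \<Longrightarrow> (\<lambda>u. c * \<phi> u) \<in> norm_space \<iota> F M"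
  by (auto simp: norm_space_def)

text \<open>For a change of the second divisor this is linearity of \<open>norm_map\<close>; for a
  change of the first, the rule already carries an arbitrary nonzero scalar.\<close>

lemma poincare_step_scale:
  assumes c: "c \<noteq> 0" and step: "poincare_step \<iota> (D, E, \<phi>) (D', E', \<phi>')"
  shows "poincare_step \<iota> (D, E, \<lambda>u. c * \<phi> u) (D', E', \<lambda>u. c * \<phi>' u)"
  using step
proof cases
  case (second_divisor f)
  have "(\<lambda>u. c * \<phi> u) \<noteq> (\<lambda>_. 0)" using second_divisor c by (auto simp: fun_eq_iff)
  from poincare_step.second_divisor[OF _ _ _ norm_space_scale this] second_divisor show ?thesis
    by (simp add: norm_map_def)
next
  case (first_divisor f s d)
  then show ?thesis using poincare_step.first_divisor[of D' \<iota> E f s "c * d"] c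
    by (simp add: mult.assoc)
qed

lemma equivclp_poincare_step_scale:
  assumes c: "c \<noteq> 0" and eq: "equivclp (poincare_step \<iota>) (D, E, \<phi>) (D', E', \<phi>')"
  shows "equivclp (poincare_step \<iota>) (D, E, \<lambda>u. c * \<phi> u) (D', E', \<lambda>u. c * \<phi>' u)"
proof -
  let ?sc = "\<lambda>(D, E, \<phi>). (D, E, \<lambda>u. c * \<phi> u)"
  have step: "poincare_step \<iota> r r' \<Longrightarrow> poincare_step \<iota> (?sc r) (?sc r')" for r r'
    using poincare_step_scale[OF c] by (cases r; cases r') auto
  have "equivclp (poincare_step \<iota>) (?sc (D, E, \<phi>)) (?sc (D', E', \<phi>'))"
    using eq by (induction rule: equivclp_induct) (auto dest: step intro: equivclp_into_equivclp simp del: split_paired_All)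
  then show ?thesis by simp
qed

text \<open>\<open>poincare_act\<close> scales every representative of a class. The result is again
  a full class because scaling by \<open>inverse c\<close> also preserves equivalence.\<close>

lemma poincare_act_point:
  assumes c: "c \<noteq> 0"
  shows "poincare_act c (poincare_point \<iota> D E \<phi>) = poincare_point \<iota> D E (\<lambda>u. c * \<phi> u)"
proof (intro Set.set_eqI iffI)
  fix r assume "r \<in> poincare_act c (poincare_point \<iota> D E \<phi>)"
  then show "r \<in> poincare_point \<iota> D E (\<lambda>u. c * \<phi> u)"
    using equivclp_poincare_step_scale[OF c] by (auto simp: poincare_act_def poincare_point_def)
next
  fix r assume r: "r \<in> poincare_point \<iota> D E (\<lambda>u. c * \<phi> u)"
  obtain D' E' \<psi> where r': "r = (D', E', \<psi>)" by (cases r)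
  have "equivclp (poincare_step \<iota>) (D, E, \<lambda>u. inverse c * (c * \<phi> u)) (D', E', \<lambda>u. inverse c * \<psi> u)"
    using r r' c by (intro equivclp_poincare_step_scale) (auto simp: poincare_point_def)
  then have "(D', E', \<lambda>u. inverse c * \<psi> u) \<in> poincare_point \<iota> D E \<phi>"
    using c by (simp add: poincare_point_def flip: mult.assoc)
  moreover have "r = (D', E', \<lambda>u. c * (inverse c * \<psi> u))" using r' c by (simp flip: mult.assoc)
  ultimately show "r \<in> poincare_act c (poincare_point \<iota> D E \<phi>)"
    unfolding poincare_act_def
    by (intro CollectI exI[of _ D'] exI[of _ E'] exI[of _ "\<lambda>u. inverse c * \<psi> u"]) simp
qed

lemma poincare_point_eqI:
  "equivclp (poincare_step \<iota>) (D, E, \<phi>) (D', E', \<phi>') \<Longrightarrow> poincare_point \<iota> D E \<phi> = poincare_point \<iota> D' E' \<phi>'"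
  unfolding poincare_point_def by (blast intro: equivclp_trans equivclp_sym)

lemma poincare_point_mem_fibre:
  "(D, E, \<phi>) \<in> poincare_reps \<iota> \<Longrightarrow>
    poincare_point \<iota> D E \<phi> \<in> poincare_fibre \<iota> (div_class \<iota> D) (div_class \<iota> E)"
  unfolding poincare_fibre_def by blast

section \<open>Comparison of the two points of the torsor\<close>

theorem mainTheorem12:
  fixes \<iota> :: "'k::field \<Rightarrow> 'f::field"
    and g :: nat
    and L :: "('f, 'm::ab_group_add) line_bundle"
    and \<delta> :: int
    and P1 P2 Q1 Q2 :: "'f set"
    and \<tau>1 \<tau>2 :: 'm
    and d0 e0 v w d2 e2 d3 e3 s :: "'m \<Rightarrow> 'f"
    and t T :: 'f
    and D E D0 E0 :: "'f divisor"
    and \<mu> lam_s \<nu> :: 'k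
  assumes curve: "function_field_one_var \<iota>" "geometrically_integral \<iota>" "has_genus \<iota> g"
      "rational_points \<iota> \<noteq> {}"
    and L: "is_line_bundle \<iota> L" "has_degree \<iota> L \<delta>" "\<delta> \<ge> 2 * int g + 1"
    and base: "d0 \<in> global_sections \<iota> L 1" "d0 \<noteq> 0" "e0 \<in> global_sections \<iota> L 1" "e0 \<noteq> 0"
    and D0_def: "D0 = section_div \<iota> L d0" and E0_def: "E0 = section_div \<iota> L e0"
    and base_disjoint: "disjoint_div D0 E0"
    and points: "P1 \<in> rational_points \<iota>" "P2 \<in> rational_points \<iota>"
      "Q1 \<in> rational_points \<iota>" "Q2 \<in> rational_points \<iota>"
    and trivialisations: "local_generator L P1 \<tau>1" "local_generator L P2 \<tau>2" "P1 = P2 \<longrightarrow> \<tau>1 = \<tau>2"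
    and vw: "v \<in> global_sections \<iota> L 1" "w \<in> global_sections \<iota> L 1"
      "order_zero_at L Q1 w" "order_zero_at L Q2 w"
    and t_def: "t = section_ratio v w"
    and T_def: "T = (t - \<iota> (value_at \<iota> Q2 t)) / (t - \<iota> (value_at \<iota> Q1 t))"
    and T_regular: "local_generator (O_div (point Q1 - point Q2)) P1 T"
      "local_generator (O_div (point Q1 - point Q2)) P2 T"
    and sections2: "d2 \<in> global_sections \<iota> L 2" "d2 \<noteq> 0" "e2 \<in> global_sections \<iota> L 2" "e2 \<noteq> 0"
    and sections3: "d3 \<in> global_sections \<iota> L 3" "d3 \<noteq> 0" "e3 \<in> global_sections \<iota> L 3" "e3 \<noteq> 0"
    and DE: "effective \<iota> D" "div_degree \<iota> D = \<delta>" "effective \<iota> E" "div_degree \<iota> E = \<delta>"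
    and P_eq: "point P1 - point P2 = D + section_div \<iota> L d2 - section_div \<iota> L d3"
    and Q_eq: "point Q1 - point Q2 = E + section_div \<iota> L e2 - section_div \<iota> L e3"
    and DE_disjoint: "disjoint_div D E" "disjoint_div D E0" "disjoint_div D0 E"
    and s: "s \<in> global_sections \<iota> L 1" "order_zero_at L P1 s" "order_zero_at L P2 s"
    and order_zero:
      "order_zero_at L P1 (\<lambda>u. e2 u / (v u - \<iota> (value_at \<iota> Q1 t) * w u))"
      "order_zero_at L P2 (\<lambda>u. e2 u / (v u - \<iota> (value_at \<iota> Q1 t) * w u))"
      "order_zero_at L P1 (\<lambda>u. (v u - \<iota> (value_at \<iota> Q2 t) * w u) / e3 u)"
      "order_zero_at L P2 (\<lambda>u. (v u - \<iota> (value_at \<iota> Q2 t) * w u) / e3 u)"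
    and d_disjoint:
      "disjoint_div (section_div \<iota> L (\<lambda>u. d2 u * d0 u)) E"
      "disjoint_div (section_div \<iota> L (\<lambda>u. d2 u * d0 u)) (section_div \<iota> L s)"
      "disjoint_div (section_div \<iota> L d3) E"
      "disjoint_div (section_div \<iota> L d3) (section_div \<iota> L s)"
    and s_disjoint:
      "disjoint_div (section_div \<iota> L s) D0" "disjoint_div (section_div \<iota> L s) D"
      "disjoint_div E0 D0" "disjoint_div E0 D"
    and \<mu>_def: "\<mu> =
      (section_value \<iota> P1 \<tau>1 (\<lambda>u. e2 u / (v u - \<iota> (value_at \<iota> Q1 t) * w u)) /
       section_value \<iota> P2 \<tau>2 (\<lambda>u. e2 u / (v u - \<iota> (value_at \<iota> Q1 t) * w u))) *
      (section_value \<iota> P1 \<tau>1 (\<lambda>u. (v u - \<iota> (value_at \<iota> Q2 t) * w u) / e3 u) /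
       section_value \<iota> P2 \<tau>2 (\<lambda>u. (v u - \<iota> (value_at \<iota> Q2 t) * w u) / e3 u))"
    and lam_s_def: "lam_s = section_value \<iota> P1 \<tau>1 s / section_value \<iota> P2 \<tau>2 s"
    and \<nu>_def: "\<nu> =
      fun_at_div \<iota> (section_ratio (\<lambda>u. d2 u * d0 u) d3) E *
      fun_at_div \<iota> (section_ratio d3 (\<lambda>u. d2 u * d0 u)) (section_div \<iota> L s) *
      fun_at_div \<iota> (section_ratio s e0) D0 *
      fun_at_div \<iota> (section_ratio e0 s) D"
  shows "poincare_point \<iota> (point P1 - point P2) (point Q1 - point Q2)
           (section_norm \<iota> (point P1 - point P2) (O_div (point Q1 - point Q2)) T)
         \<in> poincare_fibre \<iota> (div_class \<iota> (point P1 - point P2)) (div_class \<iota> (point Q1 - point Q2)) \<and>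
         poincare_point \<iota> (point P1 - point P2) (point Q1 - point Q2)
           (section_norm \<iota> (point P1 - point P2) (O_div (point Q1 - point Q2)) T)
         = poincare_act (\<mu> * lam_s * \<nu>) (poincare_bracket \<iota> D0 E0 D E)"
proof -
  have "field_hom \<iota>" using curve(1) by (simp add: function_field_one_var_def)
  then interpret curve_line_bundle \<iota> L
    using curve(1) L(1) by (simp add: curve_line_bundle_def function_field_def
        function_field_axioms_def curve_line_bundle_axioms_def)
  have ps: "\<sigma> \<in> power_sections L n" if "\<sigma> \<in> global_sections \<iota> L n" for \<sigma> n
    using that by (simp add: global_sections_def)
  have rat: "P \<in> closed_points \<iota>" if "P \<in> rational_points \<iota>" for P
    using that by (simp add: rational_points_def)
  note P1 = rat[OF points(1)] and P2 = rat[OF points(2)] and Q1 = rat[OF points(3)] and Q2 = rat[OF points(4)]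
  have \<tau>: "\<tau>1 \<noteq> 0" "\<tau>2 \<noteq> 0" using trivialisations by (auto simp: local_generator_def)
  have s0: "s \<noteq> 0" using s(2) trivialisations(1) by (auto simp: order_zero_at_def units_at_def)
  have w0: "w \<noteq> 0"
    using local_generator_exists[OF Q1] vw(3) by (auto simp: order_zero_at_def units_at_def)
  note d0 = ps[OF base(1)] base(2) and e0 = ps[OF base(3)] base(4)
    and d2 = ps[OF sections2(1)] sections2(2) and e2 = ps[OF sections2(3)] sections2(4)
    and d3 = ps[OF sections3(1)] sections3(2) and e3 = ps[OF sections3(3)] sections3(4)
    and s1 = ps[OF s(1)] s0 and w1 = ps[OF vw(2)] w0 and v1 = ps[OF vw(1)]
  have dd: "(\<lambda>u. d2 u * d0 u) \<in> power_sections L 3" "(\<lambda>u. d2 u * d0 u) \<noteq> 0"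
    using power_sections_mult[OF d2(1) d0(1)] power_sections_mult_nonzero[OF d2 d0] by simp_all
  have ee: "(\<lambda>u. e2 u * e0 u) \<in> power_sections L 3" "(\<lambda>u. e2 u * e0 u) \<noteq> 0"
    using power_sections_mult[OF e2(1) e0(1)] power_sections_mult_nonzero[OF e2 e0] by simp_all
  define f where "f = section_ratio (\<lambda>u. d2 u * d0 u) d3"
  define h where "h = section_ratio (\<lambda>u. e2 u * e0 u) e3"
  define \<sigma> where "\<sigma> = section_ratio e0 s"
  have nz: "f \<noteq> 0" "h \<noteq> 0" "\<sigma> \<noteq> 0" unfolding f_def h_def \<sigma>_def
    by (rule section_ratio_nonzero dd d3 ee e3 e0 s1)+
  let ?P = "point P1 - point P2" and ?Q = "point Q1 - point Q2"
  let ?D = "D - D0" and ?E = "E - E0" and ?S = "section_div \<iota> L s"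
  have Pf: "?P = ?D + principal_div \<iota> f"
    unfolding f_def principal_div_section_ratio[OF dd d3] section_div_mult[OF d2 d0] P_eq D0_def
    by simp
  have Qh: "?Q = ?E + principal_div \<iota> h"
    unfolding h_def principal_div_section_ratio[OF ee e3] section_div_mult[OF e2 e0] Q_eq E0_def
    by simp
  have dv: "is_divisor \<iota> D" "is_divisor \<iota> E" "is_divisor \<iota> D0" "is_divisor \<iota> E0" "is_divisor \<iota> ?S"
    using DE is_divisor_section_div[OF d0] is_divisor_section_div[OF e0] is_divisor_section_div[OF s1]
    by (auto simp: effective_def D0_def E0_def)
  have dvp: "is_divisor \<iota> (point R)" if "R \<in> closed_points \<iota>" for R
    using that by (simp add: is_divisor_def point_def)
  have dvP: "is_divisor \<iota> ?P" and dvQ: "is_divisor \<iota> ?Q" and dvD: "is_divisor \<iota> ?D" and dvE: "is_divisor \<iota> ?E"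
    by (intro is_divisor_diff dvp P1 P2 Q1 Q2 dv)+
  have deg1: "div_degree \<iota> (point R) = 1" if R: "R \<in> rational_points \<iota>" for R
    using curve_point.point_degree_rational[OF curve_pointI[OF rat[OF R]] R]
    by (simp add: div_degree_def point_def)
  have Div0: "?P \<in> Div0 \<iota>" "?Q \<in> Div0 \<iota>" "?D \<in> Div0 \<iota>" "?E \<in> Div0 \<iota>"
    using dvP dvQ dvD dvE DE degree_section_div[OF L(2) d0] degree_section_div[OF L(2) e0] points
    by (simp_all add: Div0_def div_degree_diff deg1 D0_def E0_def)

  \<comment> \<open>Multiplying numerator and denominator by the coordinate \<open>w u\<close>
    writes \<open>T\<close> as a quotient of sections of \<open>L\<close>, in every
    coordinate.\<close>
  have T_eq: "T = (v u - \<iota> (value_at \<iota> Q2 t) * w u) / (v u - \<iota> (value_at \<iota> Q1 t) * w u)" if "u \<noteq> 0" for u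
  proof -
    have "w u \<noteq> 0" by (rule power_section_nonzero[OF w1 that])
    moreover have "v u = t * w u" using \<open>w u \<noteq> 0\<close> by (simp add: t_def section_ratio_eq[OF v1 w1 that])
    ultimately show ?thesis by (simp add: T_def flip: left_diff_distrib)
  qed
  define A where "A u = e2 u / (v u - \<iota> (value_at \<iota> Q1 t) * w u)" for u
  define B where "B u = (v u - \<iota> (value_at \<iota> Q2 t) * w u) / e3 u" for u
  define G where "G = h * T / \<sigma>"
  \<comment> \<open>The factors \<open>e0\<close> in \<open>h\<close> and \<open>\<sigma>\<close>
    cancel. The identity holds for every nonzero \<open>u\<close>, so it may be read with
    \<open>\<tau>1\<close> at \<open>P1\<close> and with \<open>\<tau>2\<close> at
    \<open>P2\<close>.\<close>
  have G_eq: "G = A u * B u * s u" if u: "u \<noteq> 0" for u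
    using power_section_nonzero[OF e0 u] power_section_nonzero[OF s1 u] power_section_nonzero[OF e3 u]
    unfolding G_def h_def \<sigma>_def A_def B_def T_eq[OF u] section_ratio_eq[OF ee(1) e3 u]
      section_ratio_eq[OF e0(1) s1 u] by (simp add: mult_ac)
  have hT: "h * T = G * \<sigma>" using nz by (simp add: G_def)
  have G_point: "G \<in> units_at R \<and> fun_at_div \<iota> G (point R) =
      section_value \<iota> R \<tau> A * section_value \<iota> R \<tau> B * section_value \<iota> R \<tau> s \<and>
      fun_at_div \<iota> G (point R) \<noteq> 0"
    if R: "R \<in> rational_points \<iota>" and \<tau>: "local_generator L R \<tau>"
      and o: "order_zero_at L R A" "order_zero_at L R B" "order_zero_at L R s" for R \<tau>
  proof -
    interpret R: curve_point \<iota> R by (rule curve_pointI[OF rat[OF R]])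
    have u: "A \<tau> \<in> units_at R" "B \<tau> \<in> units_at R" "s \<tau> \<in> units_at R"
      using o \<tau> by (auto simp: order_zero_at_def)
    have uP: "A \<tau> \<in> R" "B \<tau> \<in> R" "s \<tau> \<in> R" using u by (auto simp: units_at_def)
    have eq: "G = A \<tau> * B \<tau> * s \<tau>" using \<tau> by (intro G_eq) (simp add: local_generator_def)
    have unit: "G \<in> units_at R" unfolding eq by (intro R.units_mult u)
    have "fun_at_div \<iota> G (point R) = residue_norm \<iota> R G" by (simp add: fun_at_div_def point_def)
    also have "\<dots> = residue_norm \<iota> R (A \<tau>) * residue_norm \<iota> R (B \<tau>) * residue_norm \<iota> R (s \<tau>)"
      unfolding eq using uP by (simp add: R.residue_norm_mult R.mult_mem)
    also have "\<dots> = section_value \<iota> R \<tau> A * section_value \<iota> R \<tau> B * section_value \<iota> R \<tau> s"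
      using uP by (simp add: R.residue_norm_rational[OF R] section_value_def)
    finally show ?thesis using unit fun_at_div_nonzero[OF dvp[OF rat[OF R]], of G] by (simp add: point_def)
  qed
  note GP1 = G_point[OF points(1) trivialisations(1) order_zero(1,3)[folded A_def B_def] s(2)]
    and GP2 = G_point[OF points(2) trivialisations(2) order_zero(2,4)[folded A_def B_def] s(3)]
  have keysP: "Poly_Mapping.keys ?P \<subseteq> {P1, P2}"
    using Poly_Mapping.keys_diff[of "point P1" "point P2"] by (auto simp: point_def)
  have G_unit: "G \<in> units_at R" if "R \<in> Poly_Mapping.keys ?P" for R
    using that keysP GP1 GP2 by blast
  have "fun_at_div \<iota> G ?P = fun_at_div \<iota> G (point P1) / fun_at_div \<iota> G (point P2)"
    by (rule fun_at_div_diff_units) (use GP1 GP2 dvp P1 P2 in \<open>auto simp: point_def\<close>)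
  then have G_val: "fun_at_div \<iota> G ?P = \<mu> * lam_s"
    using GP1 GP2 by (simp add: \<mu>_def lam_s_def A_def[abs_def] B_def[abs_def])
  have G_nz: "\<mu> * lam_s \<noteq> 0" using fun_at_div_nonzero[OF dvP G_unit] G_val by simp

  have T_gen: "local_generator (O_div ?Q) R T" if "R \<in> Poly_Mapping.keys ?P" for R
    using that keysP T_regular by blast
  \<comment> \<open>\<open>T\<close> generates \<open>O(E - E0 + (h))\<close> here, so
    \<open>h T\<close> generates \<open>O(E - E0)\<close>; as \<open>h T = G \<sigma>\<close> with
    \<open>G\<close> a unit, so does \<open>\<sigma>\<close>.\<close>
  have \<sigma>_gen: "local_generator (O_div ?E) R \<sigma>" if R: "R \<in> Poly_Mapping.keys ?P" for R
  proof -
    have Rc: "R \<in> closed_points \<iota>" using dvP R by (auto simp: is_divisor_def)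
    then interpret R: curve_point \<iota> R by (rule curve_pointI)
    have T: "T \<noteq> 0" "ord_at R T = - Poly_Mapping.lookup ?E R - ord_at R h"
      using T_gen[OF R] Rc unfolding Qh
      by (auto simp: R.local_generator_O_div lookup_add lookup_principal_div[OF nz(2)])
    have G: "G \<noteq> 0" "ord_at R G = 0" using G_unit[OF R] by (simp_all add: R.ord_unit_iff)
    have "ord_at R h + ord_at R T = ord_at R G + ord_at R \<sigma>"
      using hT R.ord_mult[of h T] R.ord_mult[of G \<sigma>] T(1) G(1) nz by simp
    then show ?thesis using T G nz by (simp add: R.local_generator_O_div)
  qed

  let ?\<phi> = "section_norm \<iota> ?P (O_div ?Q) T"
  have \<phi>: "?\<phi> \<in> norm_space \<iota> ?P (O_div ?Q)" "?\<phi> \<noteq> (\<lambda>_. 0)"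
    using section_norm_mem_norm_space[OF dvP T_gen] section_norm_nonzero[OF dvP T_gen] by blast+
  have fibre: "poincare_point \<iota> ?P ?Q ?\<phi> \<in> poincare_fibre \<iota> (div_class \<iota> ?P) (div_class \<iota> ?Q)"
    by (rule poincare_point_mem_fibre) (use Div0 \<phi> in \<open>simp add: poincare_reps_def\<close>)

  have step1: "poincare_step \<iota> (?P, ?Q, ?\<phi>)
      (?P, ?E, \<lambda>u. (\<mu> * lam_s) * section_norm \<iota> ?P (O_div ?E) \<sigma> u)"
  proof -
    have "norm_map (\<lambda>x. h * x) (section_norm \<iota> ?P (O_div (?E + principal_div \<iota> h)) T)
        = (\<lambda>u. (\<mu> * lam_s) * section_norm \<iota> ?P (O_div ?E) \<sigma> u)"
      unfolding norm_map_section_norm[OF dvP nz(2)] hT G_val[symmetric]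
      by (rule ext, rule section_norm_mult[OF dvP G_unit \<sigma>_gen])
    then show ?thesis
      using poincare_step.second_divisor[OF Div0(1,4) nz(2) \<phi>[unfolded Qh]] unfolding Qh by metis
  qed

  \<comment> \<open>The divisor of the function \<open>\<sigma>\<close> is \<open>E0 - (s)\<close>,
    and viewing it as a section of \<open>O(E - E0)\<close> adds \<open>E - E0\<close>.\<close>
  have div\<sigma>: "section_div \<iota> (O_div ?E) (coordinate (O_div ?E) \<sigma>) = E - ?S"
    using section_div_O_div[OF dvE nz(3)] principal_div_section_ratio[OF e0 s1]
    by (simp add: \<sigma>_def[symmetric] E0_def[symmetric])
  have keysD: "Poly_Mapping.keys ?D \<subseteq> Poly_Mapping.keys D \<union> Poly_Mapping.keys D0"
    and keysES: "Poly_Mapping.keys (E - ?S) \<subseteq> Poly_Mapping.keys E \<union> Poly_Mapping.keys ?S"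
    by (rule Poly_Mapping.keys_diff)+
  have keysf: "Poly_Mapping.keys (principal_div \<iota> f) \<subseteq>
      Poly_Mapping.keys (section_div \<iota> L (\<lambda>u. d2 u * d0 u)) \<union> Poly_Mapping.keys (section_div \<iota> L d3)"
    unfolding f_def principal_div_section_ratio[OF dd d3] by (rule Poly_Mapping.keys_diff)
  have disj: "disjoint_div (E - ?S) ?D" "disjoint_div (E - ?S) (principal_div \<iota> f)"
    using disjoint_div_Un[OF keysES keysD] disjoint_div_Un[OF keysES keysf]
      DE_disjoint d_disjoint s_disjoint by (simp_all add: disjoint_div_commute)
  \<comment> \<open>The rule is applied with the scalar \<open>\<mu> * lam_s\<close>, which is
    nonzero as a value of \<open>G\<close> at a divisor where \<open>G\<close> is a unit.\<close>
  have step2: "poincare_step \<iota> (?P, ?E, \<lambda>u. (\<mu> * lam_s) * section_norm \<iota> ?P (O_div ?E) \<sigma> u)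
      (?D, ?E, \<lambda>u. (\<mu> * lam_s) * (fun_at_div \<iota> f (E - ?S) * section_norm \<iota> ?D (O_div ?E) \<sigma> u))"
    using poincare_step.first_divisor[OF Div0(3,4) nz(1,3) G_nz, unfolded div\<sigma>, OF disj]
    unfolding Pf .

  have f_unit: "f \<in> units_at R" if "R \<in> Poly_Mapping.keys E \<union> Poly_Mapping.keys ?S" for R
  proof -
    have "R \<in> closed_points \<iota>" using that dv by (auto simp: is_divisor_def)
    then show ?thesis unfolding f_def using that d_disjoint
      by (intro section_ratio_unit[OF dd d3]) (auto simp: disjoint_div_def)
  qed
  have \<sigma>_unit: "\<sigma> \<in> units_at R" if "R \<in> Poly_Mapping.keys D \<union> Poly_Mapping.keys D0" for R
  proof -
    have "R \<in> closed_points \<iota>" using that dv by (auto simp: is_divisor_def)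
    then show ?thesis unfolding \<sigma>_def using that s_disjoint
      by (intro section_ratio_unit[OF e0 s1]) (auto simp: disjoint_div_def E0_def)
  qed
  \<comment> \<open>The support of \<open>D - D0\<close> avoids \<open>E\<close> and
    \<open>E0\<close>, so \<open>O(E - E0)\<close> is trivial there and \<open>\<sigma>\<close> can
    be compared with \<open>1\<close>.\<close>
  have one_gen: "local_generator (O_div ?E) R 1" if R: "R \<in> Poly_Mapping.keys ?D" for R
  proof -
    interpret R: curve_point \<iota> R using dvD R by (intro curve_pointI) (auto simp: is_divisor_def)
    have "R \<notin> Poly_Mapping.keys E" "R \<notin> Poly_Mapping.keys E0"
      using R keysD DE_disjoint s_disjoint unfolding disjoint_div_def by blast+
    then show ?thesis by (simp add: R.local_generator_O_div R.ord_one lookup_minus in_keys_iff)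
  qed
  \<comment> \<open>The minus signs at \<open>(s)\<close> and \<open>D0\<close> account for the two
    inverted ratios, \<open>d3 / (d2 d0)\<close> and \<open>s / e0\<close>, in the definition of
    \<open>\<nu>\<close>.\<close>
  have \<nu>: "\<nu> = fun_at_div \<iota> f (E - ?S) * fun_at_div \<iota> \<sigma> ?D"
  proof -
    have "fun_at_div \<iota> f (E - ?S) = fun_at_div \<iota> f E * fun_at_div \<iota> (inverse f) ?S"
      using fun_at_div_diff_units[OF dv(2,5) f_unit] fun_at_div_inverse[OF dv(5), of f] f_unit
      by (simp add: divide_inverse)
    moreover have "fun_at_div \<iota> \<sigma> ?D = fun_at_div \<iota> (inverse \<sigma>) D0 * fun_at_div \<iota> \<sigma> D"
      using fun_at_div_diff_units[OF dv(1,3) \<sigma>_unit] fun_at_div_inverse[OF dv(3), of \<sigma>] \<sigma>_unit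
      by (simp add: divide_inverse)
    ultimately show ?thesis
      by (simp add: \<nu>_def f_def \<sigma>_def section_ratio_swap[OF dd d3] section_ratio_swap[OF e0 s1])
  qed
  have \<nu>_nz: "\<nu> \<noteq> 0" unfolding \<nu>
    using fun_at_div_nonzero[OF is_divisor_diff[OF dv(2,5)], of f] fun_at_div_nonzero[OF dvD, of \<sigma>]
      f_unit \<sigma>_unit keysES keysD by auto
  have "section_norm \<iota> ?D (O_div ?E) \<sigma> u = fun_at_div \<iota> \<sigma> ?D * section_norm \<iota> ?D (O_div ?E) 1 u" for u
    using section_norm_mult[OF dvD _ one_gen, of \<sigma> u] \<sigma>_unit keysD by auto
  then have eq: "(\<lambda>u. (\<mu> * lam_s) * (fun_at_div \<iota> f (E - ?S) * section_norm \<iota> ?D (O_div ?E) \<sigma> u))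
      = (\<lambda>u. (\<mu> * lam_s * \<nu>) * section_norm \<iota> ?D (O_div ?E) 1 u)"
    by (simp add: \<nu> mult_ac)
  have "equivclp (poincare_step \<iota>) (?P, ?Q, ?\<phi>)
      (?D, ?E, \<lambda>u. (\<mu> * lam_s * \<nu>) * section_norm \<iota> ?D (O_div ?E) 1 u)"
    by (rule equivclp_trans[of "poincare_step \<iota>", OF r_into_equivclp[of "poincare_step \<iota>", OF step1]
          r_into_equivclp[of "poincare_step \<iota>", OF step2[unfolded eq]]])
  from poincare_point_eqI[OF this] show ?thesis
    using fibre G_nz \<nu>_nz by (simp add: poincare_act_point poincare_bracket_def poincare_pair_def)
qed

end
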